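(* Let $a>0$. With the convention $\sqrt{b^{2}x^{2}}=bx$ (see context), the following indefinite integrals in $x$ hold. (i) $$V(-2,2,a,b,x)=\sqrt{\tfrac{2}{\pi}}\int e^{-ax^{2}}b^{2+\frac12}x^{-2+\frac12}\,\tfrac12\,G_{0,2}^{2,0}\left(\tfrac{b^{2}x^{2}}{4}\,\Big|\,\tfrac54,-\tfrac54\right)dx=\sqrt{\tfrac{2}{\pi}}\int e^{-ax^{2}}b^{2+\frac12}x^{-2+\frac12}K_{\frac52}(bx)\,dx$$ $$=b^{2}\int\frac{1}{x^{2}}\left(\frac{3}{b^{2}x^{2}}+\frac{3}{bx}+1\right)e^{-ax^{2}-bx}\,dx=2\sqrt\pi\,a^{3/2}e^{\frac{b^{2}}{4a}}\operatorname{erf}\left(\frac{2ax+b}{2\sqrt a}\right)+e^{-ax^{2}-bx}\left(\frac{2a}{x}-\frac{b}{x^{2}}-\frac{1}{x^{3}}\right).$$ (ii) $$V(0,2,a,b,x)=\sqrt{\tfrac{2}{\pi}}\int e^{-ax^{2}}b^{2+\frac12}x^{0+\frac12}\,\tfrac12\,G_{0,2}^{2,0}\left(\tfrac{b^{2}x^{2}}{4}\,\Big|\,\tfrac54,-\tfrac54\right)dx=\sqrt{\tfrac{2}{\pi}}\int e^{-ax^{2}}b^{2+\frac12}x^{0+\frac12}K_{\frac52}(bx)\,dx$$ $$=b^{2}\int\left(\frac{3}{b^{2}x^{2}}+\frac{3}{bx}+1\right)e^{-ax^{2}-bx}\,dx=-\frac{\sqrt\pi\,(6a-b^{2})\,e^{\frac{b^{2}}{4a}}\operatorname{erf}\left(\frac{2ax+b}{2\sqrt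 a}\right)}{2\sqrt a}-\frac{3e^{-x(ax+b)}}{x}.$$
   Context: $K_\mu$ is the Macdonald function (modified Bessel function of the second kind), $G_{0,2}^{2,0}(z\,|\,\beta_1,\beta_2)$ is the Meijer G-function with no upper parameters and lower parameters $\beta_1,\beta_2$, and $\operatorname{erf}(z)=\frac{2}{\sqrt\pi}\int_0^z e^{-t^2}dt$. $V(h,n,a,b,x)$ is the name for the indefinite integral $\sqrt{2/\pi}\int e^{-ax^{2}}b^{n+\frac12}x^{h+\frac12}K_{n+\frac12}(bx)\,dx$. Roots are read with $\sqrt{b^{2}x^{2}}=bx$ and $\sqrt{bx}=\sqrt b\sqrt x$ (automatic for $b,x>0$). Equalities of indefinite integrals mean that the integrands agree and that the final expression is an antiderivative of them in $x$ (away from $x=0$). *)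

theory Defs
  imports "HOL-Complex_Analysis.Complex_Analysis"
begin

text \<open>
  All functions are taken on the complex plane with principal branches
  (\<open>powr\<close>, \<open>csqrt\<close>).
\<close>

definition erf :: "complex \<Rightarrow> complex" where
  "erf z = 2 / of_real (sqrt pi) * contour_integral (linepath 0 z) (\<lambda>t. exp (- t\<^sup>2))"

text \<open>
  The factor \<open>rGamma\<close> is the entire function \<open>1 / \<Gamma>\<close>, so the terms at poles of
  \<open>\<Gamma>\<close> vanish as they should.
\<close>

definition bessel_I :: "complex \<Rightarrow> complex \<Rightarrow> complex" where
  "bessel_I \<nu> z =
     (z / 2) powr \<nu> * (\<Sum>k. rGamma (\<nu> + of_nat k + 1) * (z\<^sup>2 / 4) ^ k / fact k)"

definition macdonald_K :: "complex \<Rightarrow> complex \<Rightarrow> complex" where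
  "macdonald_K \<nu> z =
     (let K = (\<lambda>\<mu>. of_real pi / 2 * (bessel_I (- \<mu>) z - bessel_I \<mu> z) / sin (\<mu> * of_real pi))
      in if \<nu> \<in> \<int> then Lim (at \<nu>) K else K \<nu>)"

text \<open>
  The Mellin--Barnes integral
  \<open>1 / (2 \<pi> i) \<integral>\<^sub>L \<Gamma> (\<beta>\<^sub>1 - s) \<Gamma> (\<beta>\<^sub>2 - s) z\<^sup>s ds\<close>.
  Since there are fewer upper than lower parameters, the loop contour, which starts and
  ends at \<open>+\<infinity>\<close> and encircles all poles of the integrand once in the negative
  sense, gives a convergent integral for every nonzero \<open>z\<close>. Here it comes in along
  \<open>Im s = -\<eta>\<close>, goes up along \<open>Re s = c\<close> and leaves along
  \<open>Im s = \<eta>\<close>; by Cauchy's theorem the particular \<open>c\<close> and \<open>\<eta>\<close>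
  are irrelevant as long as the poles \<open>\<beta>\<^sub>j + k\<close> lie inside.
\<close>

definition meijer_G_20_02 :: "complex \<Rightarrow> complex \<Rightarrow> complex \<Rightarrow> complex" where
  "meijer_G_20_02 z \<beta>1 \<beta>2 =
     (let f = (\<lambda>s. Gamma (\<beta>1 - s) * Gamma (\<beta>2 - s) * z powr s);
          c = min (Re \<beta>1) (Re \<beta>2) - 1;
          \<eta> = max \<bar>Im \<beta>1\<bar> \<bar>Im \<beta>2\<bar> + 1
      in 1 / (2 * of_real pi * \<i>) *
           (- integral {c..} (\<lambda>t. f (Complex t (- \<eta>)))
            + contour_integral (linepath (Complex c (- \<eta>)) (Complex c \<eta>)) f
            + integral {c..} (\<lambda>t. f (Complex t \<eta>))))"

text \<open>The integrand, as a function of \<open>x\<close>, of the indefinite integral \<open>V(h,n,a,b,x)\<close>.\<close>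

definition V_integrand ::
    "complex \<Rightarrow> complex \<Rightarrow> real \<Rightarrow> complex \<Rightarrow> complex \<Rightarrow> complex" where
  "V_integrand h n a b x =
     of_real (sqrt (2 / pi)) * (exp (- of_real a * x\<^sup>2) * b powr (n + 1/2) * x powr (h + 1/2)
       * macdonald_K (n + 1/2) (b * x))"

end

(*
  Closing off the loop contour of the Meijer G-function by vertical segments that move to the
  right between the poles turns it into a residue series. The functional equation of Gamma
  multiplies the integrand by z / ((beta1 - s - 1) (beta2 - s - 1)) when s moves to s + 1, so it
  decays faster than any exponential to the right, and no Stirling estimate is needed. The
  reflection formula identifies the residue series with the two Bessel series in the definition
  of K. For order 5/2 these are, up to a common factor, the even and the odd part of the series
  of (n - 1) (n - 3) z^n / n!, which gives the closed form of K_{5/2}; the antiderivatives are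
  then checked by differentiation.
*)
theory Submission
  imports Defs
begin

text \<open>The non-integer difference \<open>\<beta>1 - \<beta>2 = 5/2\<close> makes every pole of
  the Mellin-Barnes integrand simple, so each residue is a single Gamma value. The moving vertical
  edge has to miss two interleaved progressions of poles. Its abscissae are \<open>x + n\<close> for
  one fixed \<open>x\<close> off all integer translates of both parameters, so all edges are
  translates of one compact segment and a single decay estimate covers them. Rectangles run
  counterclockwise but the loop runs clockwise, and the poles of \<open>Gamma (\<beta> - s)\<close>
  bring a further minus sign; the two signs cancel. The branch conventions enter at two points:
  \<open>csqrt (w^2) = w\<close> identifies the powers of \<open>w^2 / 4\<close> in the residue
  series with powers of \<open>w / 2\<close> in the Bessel functions, and
  \<open>csqrt (b * x) = csqrt b * csqrt x\<close> cancels the root in \<open>K_{5/2}\<close>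
  against the half-integer powers of the integrand.\<close>

section \<open>Contour integrals over rectangles\<close>

text \<open>Domination by an exponential makes \<open>f\<close> absolutely integrable on the
  half-line, and dominated convergence, available for the Lebesgue integral, then carries over to
  the gauge integral used in the definition of the G-function.\<close>

lemma tendsto_integral_atLeast_exp_bound:
  fixes f :: "real \<Rightarrow> 'a::euclidean_space"
  assumes "continuous_on {c..} f" and "\<And>t. t \<ge> c \<Longrightarrow> norm (f t) \<le> C * exp (- t)"
  shows "((\<lambda>b. integral {c..b} f) \<longlongrightarrow> integral {c..} f) at_top"
proof -
  have int: "f absolutely_integrable_on {c..}"
  proof (rule measurable_bounded_by_integrable_imp_absolutely_integrable)
    show "f \<in> borel_measurable (lebesgue_on {c..})"
      using assms(1) by (intro continuous_imp_measurable_on_sets_lebesgue) auto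
    show "(\<lambda>t. C * exp (- t)) integrable_on {c..}"
      using integrable_on_exp_minus_to_infinity[of 1 c] by (intro integrable_on_mult_right) simp
  qed (use assms in auto)
  have "((\<lambda>b. set_lebesgue_integral lebesgue {c..b} f) \<longlongrightarrow> set_lebesgue_integral lebesgue {c..} f) at_top"
    by (rule tendsto_set_lebesgue_integral_at_top) (use int in auto)
  moreover have "set_lebesgue_integral lebesgue {c..b} f = integral {c..b} f" for b
    by (intro set_lebesgue_integral_eq_integral(2) set_integrable_subset[OF int]) auto
  moreover have "set_lebesgue_integral lebesgue {c..} f = integral {c..} f"
    by (intro set_lebesgue_integral_eq_integral(2) int)
  ultimately show ?thesis by simp
qed

lemma has_contour_integral_linepath_same_Im:
  assumes "(f has_contour_integral I) (linepath (Complex a y) (Complex b y))" "a < b"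
  shows "((\<lambda>t. f (Complex t y)) has_integral I) {a..b}"
proof -
  have "((\<lambda>t. f (of_real t + \<i> * of_real y)) has_integral I) {a..b}"
  proof -
    have "((\<lambda>t. f (t + \<i> * of_real y)) has_contour_integral I) (linepath (of_real a) (of_real b))"
      using assms(1) unfolding has_contour_integral_linepath
      by (simp add: linepath_def Complex_eq algebra_simps)
    then show ?thesis
      using has_contour_integral_linepath_Reals_iff[of "of_real a" "of_real b"] assms(2) by simp
  qed
  then show ?thesis by (simp add: Complex_eq)
qed

lemma contour_integral_linepath_same_Im:
  assumes "continuous_on (closed_segment (Complex a y) (Complex b y)) f" "a < b"
  shows "contour_integral (linepath (Complex a y) (Complex b y)) f = integral {a..b} (\<lambda>t. f (Complex t y))"
  using has_contour_integral_linepath_same_Im[OF has_contour_integral_integral]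
    contour_integrable_continuous_linepath assms by (metis integral_unique)

text \<open>The top and left edges are reversed, so that horizontal edges are read rightwards and
  vertical ones upwards, as in the definition of the G-function.\<close>

lemma contour_integral_rectpath:
  assumes "continuous_on (path_image (rectpath (Complex a y1) (Complex b y2))) f" "a < b"
  shows "contour_integral (rectpath (Complex a y1) (Complex b y2)) f =
           integral {a..b} (\<lambda>t. f (Complex t y1)) - integral {a..b} (\<lambda>t. f (Complex t y2))
           + contour_integral (linepath (Complex b y1) (Complex b y2)) f
           - contour_integral (linepath (Complex a y1) (Complex a y2)) f"
proof -
  have im: "path_image (rectpath (Complex a y1) (Complex b y2)) =
      closed_segment (Complex a y1) (Complex b y1) \<union> closed_segment (Complex b y1) (Complex b y2)
      \<union> closed_segment (Complex b y2) (Complex a y2) \<union> closed_segment (Complex a y2) (Complex a y1)"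
    by (auto simp: rectpath_def Let_def path_image_join)
  have co: "continuous_on (closed_segment (Complex a y1) (Complex b y1)) f"
    "continuous_on (closed_segment (Complex b y1) (Complex b y2)) f"
    "continuous_on (closed_segment (Complex b y2) (Complex a y2)) f"
    "continuous_on (closed_segment (Complex a y2) (Complex a y1)) f"
    using assms(1) unfolding im by (auto elim: continuous_on_subset)
  note ci = co[THEN contour_integrable_continuous_linepath]
  have rev: "contour_integral (linepath u v) f = - contour_integral (linepath v u) f"
    if "continuous_on (closed_segment u v) f" for u v
    using contour_integral_reverse_linepath[OF that] by simp
  have "contour_integral (rectpath (Complex a y1) (Complex b y2)) f =
     contour_integral (linepath (Complex a y1) (Complex b y1)) f
     + contour_integral (linepath (Complex b y1) (Complex b y2)) f
     - contour_integral (linepath (Complex a y2) (Complex b y2)) f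
     - contour_integral (linepath (Complex a y1) (Complex a y2)) f"
    using ci rev[OF co(3)] rev[OF co(4)]
    by (simp add: rectpath_def Let_def contour_integrable_join)
  then show ?thesis
    using contour_integral_linepath_same_Im[OF co(1) assms(2)]
      contour_integral_linepath_same_Im[of a y2 b f] co(3) assms(2)
    by (simp add: closed_segment_commute)
qed

section \<open>The Mellin--Barnes integral as a residue series\<close>

text \<open>Unconditional because both Gamma at a pole and division by zero give 0.\<close>

lemma Gamma_plus1_divide: "Gamma z = Gamma (z + 1) / (z :: complex)"
  by (metis rGamma_inverse_Gamma rGamma_plus1 inverse_inverse_eq inverse_mult_distrib
      divide_inverse mult.commute)

text \<open>Real parameters put all poles on the real axis, so that \<open>\<eta> = 1\<close> in the
  definition of the G-function.\<close>

definition mb_integrand :: "real \<Rightarrow> real \<Rightarrow> complex \<Rightarrow> complex \<Rightarrow> complex" where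
  "mb_integrand \<beta>1 \<beta>2 z s = Gamma (of_real \<beta>1 - s) * Gamma (of_real \<beta>2 - s) * z powr s"

definition mb_poles :: "real \<Rightarrow> complex set" where
  "mb_poles \<beta> = range (\<lambda>k. of_real \<beta> + of_nat k)"

lemma mb_integrand_commute: "mb_integrand \<beta>1 \<beta>2 = mb_integrand \<beta>2 \<beta>1"
  by (auto simp: mb_integrand_def fun_eq_iff)

lemma mb_poles_iff: "s \<in> mb_poles \<beta> \<longleftrightarrow> of_real \<beta> - s \<in> \<int>\<^sub>\<le>\<^sub>0"
proof
  assume "s \<in> mb_poles \<beta>" then show "of_real \<beta> - s \<in> \<int>\<^sub>\<le>\<^sub>0" by (auto simp: mb_poles_def)
next
  assume "of_real \<beta> - s \<in> \<int>\<^sub>\<le>\<^sub>0"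
  then obtain n where "of_real \<beta> - s = - of_nat n" by (auto elim: nonpos_Ints_cases')
  then have "s = of_real \<beta> + of_nat n" by (simp add: algebra_simps)
  then show "s \<in> mb_poles \<beta>" by (auto simp: mb_poles_def)
qed

lemma Ints_if_in_mb_poles: "of_real \<beta>1 + of_nat k \<in> mb_poles \<beta>2 \<Longrightarrow> \<beta>1 - \<beta>2 \<in> \<int>"
proof -
  assume "of_real \<beta>1 + of_nat k \<in> mb_poles \<beta>2"
  then obtain n where "complex_of_real \<beta>1 + of_nat k = of_real \<beta>2 + of_nat n" by (auto simp: mb_poles_def)
  then have "Re (complex_of_real \<beta>1 + of_nat k) = Re (of_real \<beta>2 + of_nat n)" by (rule arg_cong)
  then have "\<beta>1 - \<beta>2 = of_nat n - of_nat k" by simp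
  then show ?thesis by simp
qed

text \<open>Every set of integers is closed, and \<open>Q\<close> is a union of two preimages of
  such sets. Arbitrary subsets are covered because residues are taken on the complement of the poles
  left outside.\<close>

lemma closed_subset_mb_poles: "Q \<subseteq> mb_poles \<beta>1 \<union> mb_poles \<beta>2 \<Longrightarrow> closed Q"
proof -
  assume Q: "Q \<subseteq> mb_poles \<beta>1 \<union> mb_poles \<beta>2"
  define T where "T \<beta> = (\<lambda>s. of_real \<beta> - s) ` Q \<inter> \<int>\<^sub>\<le>\<^sub>0" for \<beta> :: real
  have "closed (T \<beta>)" for \<beta> unfolding T_def by (intro closed_subset_Ints) auto
  then have "closed ((\<lambda>s. of_real \<beta> - s) -` T \<beta>)" for \<beta>
    by (intro continuous_closed_vimage) (auto intro!: continuous_intros)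
  moreover have "Q = (\<lambda>s. of_real \<beta>1 - s) -` T \<beta>1 \<union> (\<lambda>s. of_real \<beta>2 - s) -` T \<beta>2"
    using Q by (auto simp: T_def mb_poles_iff)
  ultimately show ?thesis by (metis closed_Un)
qed

lemma holomorphic_mb_integrand:
  assumes "z \<noteq> 0" "A \<inter> (mb_poles \<beta>1 \<union> mb_poles \<beta>2) = {}"
  shows "mb_integrand \<beta>1 \<beta>2 z holomorphic_on A"
  using assms unfolding mb_integrand_def
  by (intro holomorphic_intros) (auto simp: mb_poles_iff)

section \<open>Decay of the integrand under translation to the right\<close>

lemma mb_integrand_plus1:
  assumes "z \<noteq> 0"
  shows "mb_integrand \<beta>1 \<beta>2 z (s + 1) =
    mb_integrand \<beta>1 \<beta>2 z s * (z / ((of_real \<beta>1 - s - 1) * (of_real \<beta>2 - s - 1)))"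
  using assms Gamma_plus1_divide[of "of_real \<beta>1 - s - 1"] Gamma_plus1_divide[of "of_real \<beta>2 - s - 1"]
  by (simp add: mb_integrand_def powr_add algebra_simps)

text \<open>Far to the right each unit step multiplies the integrand by a factor of norm at most
  \<open>1/3\<close>, which is below \<open>exp (- 1)\<close>. The finitely many earlier translates
  of \<open>K\<close> are bounded by compactness and absorbed into the constant.\<close>

lemma mb_integrand_decay:
  assumes "z \<noteq> 0" "compact K"
    and cont: "\<And>n. continuous_on ((\<lambda>s. s + of_nat n) ` K) (mb_integrand \<beta>1 \<beta>2 z)"
  shows "\<exists>C\<ge>0. \<forall>n. \<forall>s\<in>K. norm (mb_integrand \<beta>1 \<beta>2 z (s + of_nat n)) \<le> C * exp (- real n)"
proof -
  let ?f = "mb_integrand \<beta>1 \<beta>2 z"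
  have "\<exists>b\<ge>0. \<forall>s\<in>K. norm (?f (s + of_nat n)) \<le> b" for n
  proof -
    have "compact ((\<lambda>s. s + of_nat n) ` K)"
      by (intro compact_continuous_image continuous_intros assms)
    then have "compact (?f ` (\<lambda>s. s + of_nat n) ` K)"
      using cont by (rule compact_continuous_image[rotated])
    then have "bounded (?f ` (\<lambda>s. s + of_nat n) ` K)" by (rule compact_imp_bounded)
    then show ?thesis by (auto simp: bounded_pos intro: less_imp_le)
  qed
  then obtain b where b0: "\<And>n. b n \<ge> 0" and b: "\<And>n s. s \<in> K \<Longrightarrow> norm (?f (s + of_nat n)) \<le> b n"
    by metis
  obtain B where B: "\<And>s. s \<in> K \<Longrightarrow> norm s \<le> B"
    using compact_imp_bounded[OF \<open>compact K\<close>] by (auto simp: bounded_iff)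
  \<comment> \<open>From \<open>n0\<close> on, one denominator of the functional equation has norm
    at least \<open>3 * norm z\<close> and the other at least 1, which gives the ratio
    \<open>1/3\<close>.\<close>
  obtain n0 :: nat where n0: "real n0 \<ge> B + \<bar>\<beta>1\<bar> + \<bar>\<beta>2\<bar> + 3 * norm z"
    using real_arch_simple by blast
  \<comment> \<open>Each summand is nonnegative, so \<open>C\<close> dominates
    \<open>b n * exp n\<close> for every \<open>n \<le> n0\<close> at once.\<close>
  define C where "C = (\<Sum>n\<le>n0. b n * exp (real n))"
  have C0: "C \<ge> 0" unfolding C_def by (intro sum_nonneg mult_nonneg_nonneg) (auto simp: b0)
  have "norm (?f (s + of_nat n)) \<le> C * exp (- real n)" if s: "s \<in> K" for n s
  proof (induction n)
    case 0
    have "b 0 * exp (real 0) \<le> C"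
      unfolding C_def by (rule member_le_sum) (auto simp: b0)
    then show ?case using b[OF s, of 0] by simp
  next
    case (Suc n)
    show ?case
    proof (cases "Suc n \<le> n0")
      case True
      have "b (Suc n) * exp (real (Suc n)) \<le> C"
        unfolding C_def by (rule member_le_sum) (use True in \<open>auto simp: b0\<close>)
      then have "b (Suc n) \<le> C * exp (- real (Suc n))"
        by (simp only: exp_minus) (simp add: field_simps del: of_nat_Suc)
      then show ?thesis using b[OF s, of "Suc n"] by linarith
    next
      case False
      then have n: "real n \<ge> real n0" by simp
      have low: "norm (of_real \<beta> - (s + of_nat n) - 1) \<ge> real n + 1 - B - \<bar>\<beta>\<bar>" for \<beta>
      proof -
        have "norm (of_nat (n + 1) :: complex) \<le> norm (of_real \<beta> - (s + of_nat n) - 1) + norm (of_real \<beta> - s)"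
          using norm_triangle_ineq4[of "of_real \<beta> - s" "of_real \<beta> - (s + of_nat n) - 1"]
          by (simp add: algebra_simps)
        moreover have "norm (of_real \<beta> - s) \<le> \<bar>\<beta>\<bar> + B"
          using norm_triangle_ineq4[of "of_real \<beta>" s] B[OF s] by simp
        ultimately show ?thesis unfolding norm_of_nat by simp
      qed
      have "norm (of_real \<beta>1 - (s + of_nat n) - 1) \<ge> 3 * norm z"
        using low[of \<beta>1] n n0 by linarith
      moreover have "norm (of_real \<beta>2 - (s + of_nat n) - 1) \<ge> 1"
        using low[of \<beta>2] n n0 norm_ge_zero[of z] by linarith
      ultimately have "3 * norm z * 1 \<le> norm (of_real \<beta>1 - (s + of_nat n) - 1) * norm (of_real \<beta>2 - (s + of_nat n) - 1)"
        by (intro mult_mono) auto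
      then have q: "norm (z / ((of_real \<beta>1 - (s + of_nat n) - 1) * (of_real \<beta>2 - (s + of_nat n) - 1))) \<le> 1 / 3"
        using \<open>z \<noteq> 0\<close> unfolding norm_divide norm_mult
        by (subst pos_divide_le_eq) (auto intro: less_le_trans[of 0 "3 * norm z * 1"])
      have e: "1 / 3 \<le> exp (- 1 :: real)"
        using exp_le by (simp add: exp_minus field_simps)
      have "norm (?f (s + of_nat (Suc n))) \<le> norm (?f (s + of_nat n)) * (1 / 3)"
        using mult_left_mono[OF q norm_ge_zero[of "?f (s + of_nat n)"]] mb_integrand_plus1[OF \<open>z \<noteq> 0\<close>, of \<beta>1 \<beta>2 "s + of_nat n"]
        by (simp add: norm_mult[symmetric] add_ac del: times_divide_eq_right)
      also have "\<dots> \<le> (C * exp (- real n)) * exp (- 1)"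
        by (intro mult_mono Suc.IH e) (auto simp: C0)
      also have "\<dots> = C * exp (- real (Suc n))"
        by (simp add: exp_diff exp_minus exp_add field_simps)
      finally show ?thesis .
    qed
  qed
  then show ?thesis using C0 by blast
qed

section \<open>Residues and the integral over a finite rectangle\<close>

definition mb_term :: "real \<Rightarrow> real \<Rightarrow> complex \<Rightarrow> nat \<Rightarrow> complex" where
  "mb_term \<beta>1 \<beta>2 z k =
     (-1) ^ k / fact k * Gamma (of_real \<beta>2 - of_real \<beta>1 - of_nat k) * z powr (of_real \<beta>1 + of_nat k)"

text \<open>Since \<open>\<beta>1 - \<beta>2\<close> is not an integer, the second Gamma factor is
  regular at the pole, which is therefore simple. The minus sign arises because
  \<open>\<beta>1 - s\<close> reverses the direction of \<open>s\<close> in the residue of Gamma at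
  \<open>- k\<close>.\<close>

lemma residue_mb_integrand:
  assumes "z \<noteq> 0" "\<beta>1 - \<beta>2 \<notin> \<int>"
  shows "residue (mb_integrand \<beta>1 \<beta>2 z) (of_real \<beta>1 + of_nat k) = - mb_term \<beta>1 \<beta>2 z k"
proof (rule residue_simple')
  let ?p = "of_real \<beta>1 + of_nat k :: complex"
  let ?Q = "(mb_poles \<beta>1 \<union> mb_poles \<beta>2) - {?p}"
  show "open (- ?Q)"
    by (intro open_Compl closed_subset_mb_poles[of _ \<beta>1 \<beta>2]) auto
  show "?p \<in> - ?Q" by simp
  show "mb_integrand \<beta>1 \<beta>2 z holomorphic_on - ?Q - {?p}"
    by (rule holomorphic_mb_integrand) (use assms in auto)
  define g where "g = (\<lambda>s. Gamma (of_real \<beta>2 - s) * z powr s)"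
  have np: "of_real \<beta>2 - ?p \<notin> \<int>\<^sub>\<le>\<^sub>0"
    using Ints_if_in_mb_poles[of \<beta>1 k \<beta>2] assms(2) by (auto simp: mb_poles_iff)
  have g: "g \<midarrow>?p\<rightarrow> g ?p"
    unfolding g_def powr_def using assms(1) np by (simp, intro tendsto_intros) auto
  have "filterlim (\<lambda>s. of_real \<beta>1 - s) (at (- of_nat k)) (at ?p)"
  proof (rule filterlim_atI)
    show "(\<lambda>s. of_real \<beta>1 - s) \<midarrow>?p\<rightarrow> - of_nat k"
      by (rule tendsto_eq_intros refl)+ simp
    have "of_real \<beta>1 - s \<noteq> - of_nat k" if "s \<noteq> ?p" for s :: complex
      using that by (metis diff_minus_eq_add diff_eq_eq add.commute minus_diff_eq)
    then show "\<forall>\<^sub>F s in at ?p. of_real \<beta>1 - s \<noteq> - of_nat k"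
      by (simp add: eventually_at_filter)
  qed
  from filterlim_compose[OF Gamma_residues this]
  have "(\<lambda>s. Gamma (of_real \<beta>1 - s) * (of_real \<beta>1 - s + of_nat k)) \<midarrow>?p\<rightarrow> (-1) ^ k / fact k" .
  from tendsto_minus[OF tendsto_mult[OF this g]]
  have "(\<lambda>s. - (Gamma (of_real \<beta>1 - s) * (of_real \<beta>1 - s + of_nat k) * g s)) \<midarrow>?p\<rightarrow> - ((-1) ^ k / fact k * g ?p)" .
  then show "(\<lambda>s. mb_integrand \<beta>1 \<beta>2 z s * (s - ?p)) \<midarrow>?p\<rightarrow> - mb_term \<beta>1 \<beta>2 z k"
    by (simp add: mb_integrand_def mb_term_def g_def algebra_simps)
qed

text \<open>The two sums run over the poles to the left of \<open>r\<close>. The hypotheses on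
  \<open>r\<close> keep the right edge off the poles.\<close>

lemma contour_integral_rectpath_mb_integrand:
  assumes z: "z \<noteq> 0" and ni: "\<beta>1 - \<beta>2 \<notin> \<int>"
    and c: "c < \<beta>1" "c < \<beta>2" "c < r" and r: "r - \<beta>1 \<notin> \<int>" "r - \<beta>2 \<notin> \<int>"
  shows "contour_integral (rectpath (Complex c (-1)) (Complex r 1)) (mb_integrand \<beta>1 \<beta>2 z) =
           - (2 * of_real pi * \<i> * ((\<Sum>k<nat \<lceil>r - \<beta>1\<rceil>. mb_term \<beta>1 \<beta>2 z k) + (\<Sum>k<nat \<lceil>r - \<beta>2\<rceil>. mb_term \<beta>2 \<beta>1 z k)))"
proof -
  let ?f = "mb_integrand \<beta>1 \<beta>2 z"
  let ?g = "rectpath (Complex c (-1)) (Complex r 1)"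
  let ?P = "mb_poles \<beta>1 \<union> mb_poles \<beta>2"
  define pts where "pts \<beta> = (\<lambda>k. complex_of_real \<beta> + of_nat k) ` {..<nat \<lceil>r - \<beta>\<rceil>}" for \<beta>
  have pts_iff: "s \<in> pts \<beta> \<longleftrightarrow> s \<in> mb_poles \<beta> \<and> Re s < r" for s \<beta>
  proof -
    \<comment> \<open>If \<open>r \<le> \<beta>\<close> the ceiling is not positive,
      \<open>nat\<close> turns it into 0, and the sum is empty.\<close>
    have "k < nat \<lceil>r - \<beta>\<rceil> \<longleftrightarrow> \<beta> + real k < r" for k
      by (simp add: zless_nat_eq_int_zless less_ceiling_iff algebra_simps)
    then have K: "{..<nat \<lceil>r - \<beta>\<rceil>} = {k. \<beta> + real k < r}"
      by (intro set_eqI) (simp only: lessThan_iff mem_Collect_eq)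
    have "Re (of_real \<beta> + of_nat k) = \<beta> + real k" for k by simp
    then show ?thesis unfolding pts_def mb_poles_def K image_iff by (metis mem_Collect_eq UNIV_I)
  qed
  have "Re s \<noteq> r" if "s \<in> mb_poles \<beta>" "r - \<beta> \<notin> \<int>" for s \<beta>
  proof
    assume s: "Re s = r"
    from that(1) obtain k where "s = of_real \<beta> + of_nat k"
      unfolding mb_poles_def by (rule rangeE)
    then have "r - \<beta> = real k" using s by simp
    then show False using that(2) by simp
  qed
  then have pole_ne: "Re s \<noteq> r" if "s \<in> ?P" for s
    using that r by blast
  have box: "s \<in> box (Complex c (-1)) (Complex r 1)" if "s \<in> pts \<beta>1 \<union> pts \<beta>2" for s
    using that c by (auto simp: pts_iff in_box_complex_iff mb_poles_def)
  have disj: "pts \<beta>1 \<inter> pts \<beta>2 = {}"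
    using Ints_if_in_mb_poles[of \<beta>1 _ \<beta>2] ni by (auto simp: pts_iff mb_poles_def[of \<beta>1])
  have fin: "finite (pts \<beta>)" for \<beta> by (simp add: pts_def)
  \<comment> \<open>Only the poles outside the rectangle are removed: the domain is open, and
    connected as the complement of a countable set, while finitely many singularities remain in
    it.\<close>
  define S where "S = - (?P - (pts \<beta>1 \<union> pts \<beta>2))"
  have "contour_integral ?g ?f =
      2 * pi * \<i> * (\<Sum>p\<in>pts \<beta>1 \<union> pts \<beta>2. winding_number ?g p * residue ?f p)"
  proof (rule Residue_theorem[of S])
    show "open S" unfolding S_def
      by (intro open_Compl closed_subset_mb_poles[of _ \<beta>1 \<beta>2]) auto
    have "countable ?P" by (auto simp: mb_poles_def)
    then show "connected S" unfolding S_def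
      by (intro path_connected_imp_connected path_connected_complement_countable) (auto intro: countable_subset)
    show "finite (pts \<beta>1 \<union> pts \<beta>2)" by (simp add: fin)
    show "?f holomorphic_on S - (pts \<beta>1 \<union> pts \<beta>2)"
      by (rule holomorphic_mb_integrand) (use z in \<open>auto simp: S_def\<close>)
    show "path_image ?g \<subseteq> S - (pts \<beta>1 \<union> pts \<beta>2)"
    proof -
      have "path_image ?g \<inter> ?P = {}"
        using pole_ne c by (auto simp: path_image_rectpath mb_poles_def)
      then show ?thesis by (auto simp: S_def pts_iff)
    qed
    show "\<forall>s. s \<notin> S \<longrightarrow> winding_number ?g s = 0"
    proof (intro allI impI)
      fix s assume "s \<notin> S"
      \<comment> \<open>A point outside \<open>S\<close> is a pole that the rectangle leaves to its
        right.\<close>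
      then have "Re s > r" using pole_ne[of s] by (auto simp: S_def pts_iff)
      then show "winding_number ?g s = 0"
        using c by (intro winding_number_rectpath_outside) (auto simp: in_cbox_complex_iff)
    qed
  qed auto
  also have "(\<Sum>p\<in>pts \<beta>1 \<union> pts \<beta>2. winding_number ?g p * residue ?f p) =
      (\<Sum>p\<in>pts \<beta>1 \<union> pts \<beta>2. residue ?f p)"
    by (rule sum.cong) (use box winding_number_rectpath in auto)
  also have "\<dots> = (\<Sum>p\<in>pts \<beta>1. residue ?f p) + (\<Sum>p\<in>pts \<beta>2. residue ?f p)"
    by (rule sum.union_disjoint) (use fin disj in auto)
  also have "(\<Sum>p\<in>pts \<beta>1. residue ?f p) = - (\<Sum>k<nat \<lceil>r - \<beta>1\<rceil>. mb_term \<beta>1 \<beta>2 z k)"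
    unfolding pts_def using residue_mb_integrand[OF z ni]
    by (subst sum.reindex) (auto simp: inj_on_def sum_negf)
  also have "(\<Sum>p\<in>pts \<beta>2. residue ?f p) = - (\<Sum>k<nat \<lceil>r - \<beta>2\<rceil>. mb_term \<beta>2 \<beta>1 z k)"
  proof -
    have "\<beta>2 - \<beta>1 \<notin> \<int>" using ni Ints_minus[of "\<beta>2 - \<beta>1"] by auto
    from residue_mb_integrand[OF z this] show ?thesis
      unfolding pts_def mb_integrand_commute[of \<beta>2 \<beta>1]
      by (subst sum.reindex) (auto simp: inj_on_def sum_negf)
  qed
  finally show ?thesis by (simp add: algebra_simps)
qed

text \<open>The functional equation of Gamma gives the ratio
  \<open>- z / ((k + 1) * (\<delta> - k - 1))\<close> of consecutive terms. \<open>N\<close> is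
  chosen so that the second factor of the denominator has norm at least
  \<open>2 * norm z\<close>.\<close>

lemma summable_mb_term:
  assumes "z \<noteq> 0"
  shows "summable (mb_term \<beta>1 \<beta>2 z)"
proof -
  define \<delta> where "\<delta> = \<beta>2 - \<beta>1"
  obtain N :: nat where N: "real N \<ge> \<bar>\<delta>\<bar> + 2 * norm z" using real_arch_simple by blast
  show ?thesis
  proof (rule summable_ratio_test[of "1/2" N])
    fix n assume n: "n \<ge> N"
    have eq: "mb_term \<beta>1 \<beta>2 z (Suc n) = mb_term \<beta>1 \<beta>2 z n * (- z / (of_nat (Suc n) * (of_real \<delta> - of_nat (Suc n))))"
      using assms Gamma_plus1_divide[of "of_real \<beta>2 - of_real \<beta>1 - of_nat (Suc n)"]
      by (simp add: mb_term_def powr_add \<delta>_def algebra_simps)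
    have "norm (complex_of_real \<delta> - of_nat (Suc n)) \<ge> real (Suc n) - \<bar>\<delta>\<bar>"
      using norm_triangle_ineq2[of "of_nat (Suc n) :: complex" "complex_of_real \<delta>"]
      unfolding norm_of_nat norm_of_real by (simp add: norm_minus_commute)
    then have "norm (complex_of_real \<delta> - of_nat (Suc n)) \<ge> 2 * norm z" using n N by simp
    then have "1 * (2 * norm z) \<le> norm (of_nat (Suc n) :: complex) * norm (complex_of_real \<delta> - of_nat (Suc n))"
      by (intro mult_mono) (auto simp: norm_of_nat simp del: of_nat_Suc)
    then have "norm (- z / (of_nat (Suc n) * (of_real \<delta> - of_nat (Suc n)))) \<le> 1 / 2"
      using assms unfolding norm_divide norm_mult norm_minus_cancel
      by (subst pos_divide_le_eq) (auto intro: less_le_trans[of 0 "1 * (2 * norm z)"] simp del: of_nat_Suc)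
    from mult_left_mono[OF this norm_ge_zero[of "mb_term \<beta>1 \<beta>2 z n"]]
    show "norm (mb_term \<beta>1 \<beta>2 z (Suc n)) \<le> 1 / 2 * norm (mb_term \<beta>1 \<beta>2 z n)"
      unfolding eq norm_mult[of "mb_term \<beta>1 \<beta>2 z n"] by (simp only: mult.commute)
  qed simp
qed

section \<open>Sending the right edge to infinity\<close>

text \<open>The half-line is covered by integer translates of a segment of length one, where the
  decay estimate applies. Rounding \<open>t - c\<close> down costs at most one unit in the exponent,
  hence the factor \<open>exp (c + 1)\<close>.\<close>

lemma mb_integrand_decay_horizontal:
  assumes "z \<noteq> 0" "y \<noteq> 0"
  shows "\<exists>C. \<forall>t\<ge>c. norm (mb_integrand \<beta>1 \<beta>2 z (Complex t y)) \<le> C * exp (- t)"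
proof -
  let ?f = "mb_integrand \<beta>1 \<beta>2 z"
  define K where "K = (\<lambda>u. Complex u y) ` {c..c+1}"
  have "\<exists>C\<ge>0. \<forall>n. \<forall>s\<in>K. norm (?f (s + of_nat n)) \<le> C * exp (- real n)"
  proof (rule mb_integrand_decay[OF assms(1)])
    show "compact K" unfolding K_def Complex_eq by (intro compact_continuous_image continuous_intros) auto
    show "continuous_on ((\<lambda>s. s + of_nat n) ` K) ?f" for n
      by (rule holomorphic_on_imp_continuous_on[OF holomorphic_mb_integrand])
        (use assms in \<open>auto simp: K_def mb_poles_def complex_eq_iff\<close>)
  qed
  then obtain C where C: "C \<ge> 0" "\<And>n s. s \<in> K \<Longrightarrow> norm (?f (s + of_nat n)) \<le> C * exp (- real n)"
    by blast
  have "norm (?f (Complex t y)) \<le> (C * exp (c + 1)) * exp (- t)" if t: "t \<ge> c" for t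
  proof -
    define n where "n = nat \<lfloor>t - c\<rfloor>"
    have n: "real n \<le> t - c" "t - c < real n + 1" using t unfolding n_def by linarith+
    have "norm (?f (Complex (t - real n) y + of_nat n)) \<le> C * exp (- real n)"
      by (rule C(2)) (use n in \<open>auto simp: K_def\<close>)
    also have "Complex (t - real n) y + of_nat n = Complex t y" by (simp add: complex_eq_iff)
    also have "C * exp (- real n) \<le> C * exp (c + 1 + - t)"
      using n C(1) by (intro mult_left_mono) auto
    finally show ?thesis by (simp add: mult.assoc flip: exp_add)
  qed
  then show ?thesis by blast
qed

text \<open>All edges are translates of one segment of length 2 that misses the poles, so length
  times supremum decays exponentially.\<close>

lemma mb_integrand_right_edge_tendsto_0:
  assumes "z \<noteq> 0" "x - \<beta>1 \<notin> \<int>" "x - \<beta>2 \<notin> \<int>"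
  shows "(\<lambda>n. contour_integral (linepath (Complex (x + real n) (-1)) (Complex (x + real n) 1)) (mb_integrand \<beta>1 \<beta>2 z))
           \<longlonglongrightarrow> 0"
proof -
  let ?f = "mb_integrand \<beta>1 \<beta>2 z"
  define K where "K = closed_segment (Complex x (-1)) (Complex x 1)"
  have shift: "closed_segment (Complex (x + real n) (-1)) (Complex (x + real n) 1) = (\<lambda>s. s + of_nat n) ` K" for n
    using closed_segment_translation_eq closed_segment_translation[of "of_nat n" "Complex x (-1)" "Complex x 1"]
    by (simp add: K_def add.commute complex_add Complex_eq algebra_simps)
  have cont: "continuous_on ((\<lambda>s. s + of_nat n) ` K) ?f" for n
  proof (rule holomorphic_on_imp_continuous_on[OF holomorphic_mb_integrand[OF assms(1)]])
    have "s \<notin> mb_poles \<beta>" if "s \<in> (\<lambda>s. s + of_nat n) ` K" "x - \<beta> \<notin> \<int>" for s \<beta>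
    proof
      assume "s \<in> mb_poles \<beta>"
      then obtain k where "s = of_real \<beta> + of_nat k" by (auto simp: mb_poles_def)
      moreover have "Re s = x + real n"
        using that(1) by (auto simp: K_def closed_segment_same_Re)
      ultimately have "x - \<beta> = real k - real n" by simp
      then show False using that(2) by simp
    qed
    then show "(\<lambda>s. s + of_nat n) ` K \<inter> (mb_poles \<beta>1 \<union> mb_poles \<beta>2) = {}"
      using assms(2,3) by blast
  qed
  obtain C where C: "C \<ge> 0" "\<And>n s. s \<in> K \<Longrightarrow> norm (?f (s + of_nat n)) \<le> C * exp (- real n)"
    using mb_integrand_decay[OF assms(1) _ cont] by (auto simp: K_def)
  show ?thesis
  proof (rule Lim_null_comparison)
    show "\<forall>\<^sub>F n in sequentially.
        norm (contour_integral (linepath (Complex (x + real n) (-1)) (Complex (x + real n) 1)) ?f) \<le> C * exp (- real n) * 2"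
    proof (intro always_eventually allI)
      fix n
      have "norm (contour_integral (linepath (Complex (x + real n) (-1)) (Complex (x + real n) 1)) ?f)
        \<le> C * exp (- real n) * norm (Complex (x + real n) 1 - Complex (x + real n) (-1))"
        by (rule contour_integral_bound_linepath)
          (use C cont shift in \<open>auto intro!: contour_integrable_continuous_linepath\<close>)
      then show "norm (contour_integral (linepath (Complex (x + real n) (-1)) (Complex (x + real n) 1)) ?f) \<le> C * exp (- real n) * 2"
        by (simp add: complex_diff cmod_def)
    qed
    show "(\<lambda>n. C * exp (- real n) * 2) \<longlonglongrightarrow> 0" by real_asymp
  qed
qed

text \<open>The rectangle integral is evaluated both by residues and edge by edge. In the limit the
  right edge disappears and the other three become the loop contour.\<close>

theorem meijer_G_20_02_series:
  assumes z: "z \<noteq> 0" and ni: "\<beta>1 - \<beta>2 \<notin> \<int>"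
  shows "meijer_G_20_02 z (of_real \<beta>1) (of_real \<beta>2) =
           (\<Sum>k. mb_term \<beta>1 \<beta>2 z k) + (\<Sum>k. mb_term \<beta>2 \<beta>1 z k)"
proof -
  let ?f = "mb_integrand \<beta>1 \<beta>2 z"
  define c where "c = min \<beta>1 \<beta>2 - 1"
  define up where "up = contour_integral (linepath (Complex c (-1)) (Complex c 1)) ?f"
  \<comment> \<open>A cardinality argument supplies an abscissa \<open>x\<close> off both lattices
    \<open>\<beta>1 + \<int>\<close> and \<open>\<beta>2 + \<int>\<close>; all shifts
    \<open>x + n\<close> then avoid them too.\<close>
  have "uncountable {c<..<c+1}" by (simp add: uncountable_open_interval)
  moreover have "countable ((\<lambda>m. \<beta>1 + m) ` \<int> \<union> (\<lambda>m. \<beta>2 + m) ` \<int>)"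
    by (auto simp: Ints_def)
  ultimately obtain x where x: "c < x" "x \<notin> (\<lambda>m. \<beta>1 + m) ` \<int> \<union> (\<lambda>m. \<beta>2 + m) ` \<int>"
    by (meson countable_subset greaterThanLessThan_iff subsetI)
  have xni: "x - \<beta> \<notin> \<int>" if "\<beta> \<in> {\<beta>1, \<beta>2}" for \<beta>
  proof
    assume "x - \<beta> \<in> \<int>"
    then have "\<beta> + (x - \<beta>) \<in> (\<lambda>m. \<beta> + m) ` \<int>" by blast
    then show False using x that by auto
  qed
  have xnni: "x + real n - \<beta> \<notin> \<int>" if "\<beta> \<in> {\<beta>1, \<beta>2}" for \<beta> n
    using Ints_diff[of "x + real n - \<beta>" "real n"] xni[OF that] by (auto simp: algebra_simps)
  have tail: "(\<lambda>n. integral {c..x + real n} (\<lambda>t. ?f (Complex t y))) \<longlonglongrightarrow> integral {c..} (\<lambda>t. ?f (Complex t y))"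
    if y: "y \<noteq> 0" for y
  proof -
    obtain C where C: "\<And>t. t \<ge> c \<Longrightarrow> norm (?f (Complex t y)) \<le> C * exp (- t)"
      using mb_integrand_decay_horizontal[OF z y, of c] by blast
    have "continuous_on ((\<lambda>t. Complex t y) ` {c..}) ?f"
      by (rule holomorphic_on_imp_continuous_on[OF holomorphic_mb_integrand[OF z]])
        (use y in \<open>auto simp: mb_poles_def complex_eq_iff\<close>)
    then have "continuous_on {c..} (\<lambda>t. ?f (Complex t y))"
      by (rule continuous_on_compose2) (auto simp: Complex_eq intro!: continuous_intros)
    from tendsto_integral_atLeast_exp_bound[OF this C]
    have "((\<lambda>b. integral {c..b} (\<lambda>t. ?f (Complex t y))) \<longlongrightarrow> integral {c..} (\<lambda>t. ?f (Complex t y))) at_top" .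
    moreover have "filterlim (\<lambda>n. x + real n) at_top sequentially" by real_asymp
    ultimately show ?thesis by (rule filterlim_compose)
  qed
  define S where "S n = (\<Sum>k<nat \<lceil>x + real n - \<beta>1\<rceil>. mb_term \<beta>1 \<beta>2 z k) +
      (\<Sum>k<nat \<lceil>x + real n - \<beta>2\<rceil>. mb_term \<beta>2 \<beta>1 z k)" for n
  \<comment> \<open>The two partial sums stop at different indices, but both indices tend to
    infinity, so each sum tends to its full series.\<close>
  have lim: "filterlim (\<lambda>n. nat \<lceil>x + real n - \<beta>\<rceil>) at_top sequentially" for \<beta>
    unfolding filterlim_at_top
  proof
    fix Z
    have "filterlim (\<lambda>n. x + real n - \<beta>) at_top sequentially" by real_asymp
    then have "\<forall>\<^sub>F n in sequentially. real Z \<le> x + real n - \<beta>"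
      unfolding filterlim_at_top by blast
    then show "\<forall>\<^sub>F n in sequentially. Z \<le> nat \<lceil>x + real n - \<beta>\<rceil>"
      by eventually_elim linarith
  qed
  have S: "S \<longlonglongrightarrow> (\<Sum>k. mb_term \<beta>1 \<beta>2 z k) + (\<Sum>k. mb_term \<beta>2 \<beta>1 z k)"
    unfolding S_def
    by (intro tendsto_add filterlim_compose[OF summable_LIMSEQ lim] summable_mb_term z)
  have eq: "- (2 * of_real pi * \<i> * S n) =
      integral {c..x + real n} (\<lambda>t. ?f (Complex t (-1))) - integral {c..x + real n} (\<lambda>t. ?f (Complex t 1))
      + contour_integral (linepath (Complex (x + real n) (-1)) (Complex (x + real n) 1)) ?f - up" for n
  proof -
    have "continuous_on (path_image (rectpath (Complex c (-1)) (Complex (x + real n) 1))) ?f"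
    proof (rule holomorphic_on_imp_continuous_on[OF holomorphic_mb_integrand[OF z]])
      have "\<beta> + real k \<noteq> x + real n" if "\<beta> \<in> {\<beta>1, \<beta>2}" for \<beta> k
      proof
        assume "\<beta> + real k = x + real n"
        then have "x + real n - \<beta> = real k" by simp
        then show False using xnni[OF that, of n] by simp
      qed
      then show "path_image (rectpath (Complex c (-1)) (Complex (x + real n) 1)) \<inter> (mb_poles \<beta>1 \<union> mb_poles \<beta>2) = {}"
        using x by (auto simp: path_image_rectpath mb_poles_def c_def)
    qed
    from contour_integral_rectpath[OF this]
      contour_integral_rectpath_mb_integrand[OF z ni, of c "x + real n"] x xnni[of _ n]
    show ?thesis by (simp add: S_def up_def c_def)
  qed
  have "(\<lambda>n. - (2 * of_real pi * \<i> * S n)) \<longlonglongrightarrow>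
      integral {c..} (\<lambda>t. ?f (Complex t (-1))) - integral {c..} (\<lambda>t. ?f (Complex t 1)) + 0 - up"
    unfolding eq
    by (intro tendsto_intros tail mb_integrand_right_edge_tendsto_0 z xni) auto
  moreover have "(\<lambda>n. - (2 * of_real pi * \<i> * S n)) \<longlonglongrightarrow>
      - (2 * of_real pi * \<i> * ((\<Sum>k. mb_term \<beta>1 \<beta>2 z k) + (\<Sum>k. mb_term \<beta>2 \<beta>1 z k)))"
    by (intro tendsto_intros S)
  ultimately have S_eq: "2 * of_real pi * \<i> * ((\<Sum>k. mb_term \<beta>1 \<beta>2 z k) + (\<Sum>k. mb_term \<beta>2 \<beta>1 z k)) =
      - integral {c..} (\<lambda>t. ?f (Complex t (-1))) + up + integral {c..} (\<lambda>t. ?f (Complex t 1))"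
    using LIMSEQ_unique by (fastforce simp: algebra_simps)
  have "meijer_G_20_02 z (of_real \<beta>1) (of_real \<beta>2) = 1 / (2 * of_real pi * \<i>) *
      (- integral {c..} (\<lambda>t. ?f (Complex t (-1))) + up + integral {c..} (\<lambda>t. ?f (Complex t 1)))"
    by (simp add: meijer_G_20_02_def Let_def mb_integrand_def[abs_def] c_def up_def)
  also have "\<dots> = (\<Sum>k. mb_term \<beta>1 \<beta>2 z k) + (\<Sum>k. mb_term \<beta>2 \<beta>1 z k)"
    unfolding S_eq[symmetric] by simp
  finally show ?thesis .
qed

section \<open>Macdonald functions\<close>

text \<open>With \<open>w = - d - k\<close> the reflection formula turns \<open>Gamma w\<close> into
  \<open>rGamma (1 - w)\<close> times \<open>pi / sin (pi * w)\<close>. Shifting the sine by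
  \<open>k\<close> half-periods yields \<open>(-1)^k\<close>, which cancels the sign of the residue
  and leaves the non-alternating series of \<open>I\<close>.\<close>

lemma mb_term_eq:
  assumes "z \<noteq> 0" "\<beta>1 - \<beta>2 \<notin> \<int>"
  shows "mb_term \<beta>1 \<beta>2 z k = - (of_real pi / sin (of_real (\<beta>1 - \<beta>2) * of_real pi)) * z powr of_real \<beta>1 *
           (rGamma (of_real (\<beta>1 - \<beta>2) + of_nat k + 1) * z ^ k / fact k)"
proof -
  define d where "d = \<beta>1 - \<beta>2"
  define w where "w = - complex_of_real d - of_nat k"
  have sin_ne: "sin (d * pi) \<noteq> 0"
    using assms(2) by (auto simp: sin_zero_iff_int2 d_def)
  have "sin (pi * (- d - real k)) = - ((- 1) ^ k * sin (d * pi))"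
    by (simp add: algebra_simps sin_diff)
  moreover have "sin (of_real pi * w) = of_real (sin (pi * (- d - real k)))"
    by (simp add: w_def flip: sin_of_real)
  ultimately have s: "sin (of_real pi * w) = - ((- 1) ^ k * of_real (sin (d * pi)))"
    by simp
  have refl: "rGamma w * rGamma (1 - w) = - ((- 1) ^ k * of_real (sin (d * pi))) / of_real pi"
    using rGamma_reflection_complex[of w] by (simp only: s)
  have "rGamma w * (- ((- 1) ^ k) * (of_real pi / of_real (sin (d * pi))) * rGamma (1 - w)) =
      - ((- 1) ^ k) * (of_real pi / of_real (sin (d * pi))) * (rGamma w * rGamma (1 - w))"
    by (simp only: mult_ac)
  also have "\<dots> = 1"
    unfolding refl using sin_ne by (simp add: field_simps flip: power_mult_distrib)
  finally have "Gamma w = - ((- 1) ^ k) * (of_real pi / of_real (sin (d * pi))) * rGamma (1 - w)"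
    by (simp only: Gamma_def inverse_unique)
  moreover have "sin (of_real d * of_real pi :: complex) = of_real (sin (d * pi))"
    by (metis of_real_mult sin_of_real)
  moreover have "of_real \<beta>2 - of_real \<beta>1 - of_nat k = w" "1 - w = of_real d + of_nat k + 1"
    by (simp_all add: w_def d_def)
  moreover have "z powr (of_real \<beta>1 + of_nat k) = z powr of_real \<beta>1 * z ^ k"
    using assms(1) by (simp add: powr_add)
  ultimately show ?thesis
    unfolding mb_term_def d_def[symmetric] by (simp add: mult_ac flip: power_mult_distrib)
qed

lemma suminf_mb_term:
  assumes "z \<noteq> 0" "\<beta>1 - \<beta>2 \<notin> \<int>"
  shows "(\<Sum>k. mb_term \<beta>1 \<beta>2 z k) = - (of_real pi / sin (of_real (\<beta>1 - \<beta>2) * of_real pi)) * z powr of_real \<beta>1 *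
           (\<Sum>k. rGamma (of_real (\<beta>1 - \<beta>2) + of_nat k + 1) * z ^ k / fact k)"
proof -
  let ?c = "- (of_real pi / sin (of_real (\<beta>1 - \<beta>2) * of_real pi)) * z powr of_real \<beta>1 :: complex"
  let ?g = "\<lambda>k. rGamma (of_real (\<beta>1 - \<beta>2) + of_nat k + 1) * z ^ k / fact k"
  have "sin ((\<beta>1 - \<beta>2) * pi) \<noteq> 0"
    using assms(2) by (auto simp: sin_zero_iff_int2)
  then have "sin (of_real (\<beta>1 - \<beta>2) * of_real pi :: complex) \<noteq> 0"
    by (metis of_real_eq_0_iff of_real_mult sin_of_real)
  then have c: "?c \<noteq> 0" using assms(1) by simp
  have eq: "mb_term \<beta>1 \<beta>2 z = (\<lambda>k. ?c * ?g k)"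
    using mb_term_eq[OF assms] by (intro ext) (simp only:)
  have "summable (\<lambda>k. ?c * ?g k)"
    using summable_mb_term[OF assms(1), of \<beta>1 \<beta>2] unfolding eq .
  \<comment> \<open>The constant is nonzero, so the Bessel series inherits its convergence from the
    residue series.\<close>
  then have "summable ?g" using c by (simp only: summable_cmult_iff) blast
  then show ?thesis unfolding eq by (rule suminf_mult)
qed

text \<open>\<open>csqrt (w^2) = w\<close> says that \<open>w\<close> is the exponential of
  \<open>Ln (w^2) / 2\<close>, whose imaginary part lies in the principal strip; hence
  \<open>Ln (w^2) = 2 * Ln w\<close>. Division by the positive numbers 4 and 2 does not disturb the
  branch.\<close>

lemma powr_half_square:
  assumes "w \<noteq> 0" "csqrt (w\<^sup>2) = w"
  shows "(w\<^sup>2 / 4) powr (\<nu> / 2) = (w / 2) powr \<nu>"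
proof -
  have "Ln w = Ln (exp (Ln (w\<^sup>2) / 2))"
    using assms csqrt_exp_Ln[of "w\<^sup>2"] by simp
  also have "\<dots> = Ln (w\<^sup>2) / 2"
    using Im_Ln_le_pi[of "w\<^sup>2"] mpi_less_Im_Ln[of "w\<^sup>2"] assms(1) by (intro Ln_exp) auto
  finally have *: "Ln (w\<^sup>2) = 2 * Ln w" by (simp add: field_simps)
  have "ln 4 = 2 * ln (2 :: real)"
    using ln_realpow[of 2 2] by simp
  then have "Ln (w\<^sup>2 / 4) = 2 * Ln (w / 2)"
    using Ln_divide_of_real[of 4 "w\<^sup>2"] Ln_divide_of_real[of 2 w] assms(1) * by simp
  then show ?thesis using assms(1) by (simp add: powr_def)
qed

text \<open>The parameters differ by \<open>\<nu>\<close>, so the condition that keeps the poles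
  simple also selects the quotient branch in the definition of \<open>macdonald_K\<close>. The
  series at \<open>\<nu> / 2\<close> gives \<open>I_\<nu>\<close>, the one at
  \<open>- \<nu> / 2\<close> gives \<open>I_{-\<nu>}\<close>, and their opposite signs come from the
  oddness of the sine.\<close>

theorem meijer_G_20_02_eq_macdonald_K:
  fixes \<nu> :: real
  assumes w: "w \<noteq> 0" "csqrt (w\<^sup>2) = w" and \<nu>: "\<nu> \<notin> \<int>"
  shows "meijer_G_20_02 (w\<^sup>2 / 4) (of_real \<nu> / 2) (- of_real \<nu> / 2) = 2 * macdonald_K (of_real \<nu>) w"
proof -
  let ?z = "w\<^sup>2 / 4"
  have z: "?z \<noteq> 0" using w by simp
  have ni: "\<nu> / 2 - - \<nu> / 2 \<notin> \<int>" "- \<nu> / 2 - \<nu> / 2 \<notin> \<int>"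
    using \<nu> Ints_minus[of "- \<nu>"] by auto
  have "(\<Sum>k. mb_term (\<nu> / 2) (- \<nu> / 2) ?z k) = - (of_real pi / sin (of_real \<nu> * of_real pi)) * bessel_I (of_real \<nu>) w"
    unfolding suminf_mb_term[OF z ni(1)] bessel_I_def
    using powr_half_square[OF w, of "of_real \<nu>"] by simp
  moreover have "(\<Sum>k. mb_term (- \<nu> / 2) (\<nu> / 2) ?z k) = of_real pi / sin (of_real \<nu> * of_real pi) * bessel_I (- of_real \<nu>) w"
    unfolding suminf_mb_term[OF z ni(2)] bessel_I_def
    using powr_half_square[OF w, of "- of_real \<nu>"] by simp
  moreover have "complex_of_real \<nu> \<notin> \<int>"
    using \<nu> by (auto elim!: Ints_cases simp: complex_eq_iff)
  ultimately show ?thesis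
    using meijer_G_20_02_series[OF z ni(1)]
    by (simp add: macdonald_K_def Let_def right_diff_distrib diff_divide_distrib)
qed

section \<open>Bessel and Macdonald functions of order 5/2 in closed form\<close>

text \<open>Half the sum or difference of a series and its alternating companion retains the terms
  of one parity; reindexing then skips the zeros.\<close>

lemma sums_even_odd:
  fixes a :: "nat \<Rightarrow> 'a::real_normed_field"
  assumes "a sums s" "(\<lambda>n. (- 1) ^ n * a n) sums t"
  shows "(\<lambda>n. a (2 * n)) sums ((s + t) / 2)" "(\<lambda>n. a (2 * n + 1)) sums ((s - t) / 2)"
proof -
  have "(\<lambda>n. (a n + (- 1) ^ n * a n) / 2) sums ((s + t) / 2)"
    "(\<lambda>n. (a n - (- 1) ^ n * a n) / 2) sums ((s - t) / 2)"
    by (intro sums_divide sums_add sums_diff assms)+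
  moreover have "(\<lambda>n. (a n + (- 1) ^ n * a n) / 2) = (\<lambda>n. if even n then a n else 0)"
    "(\<lambda>n. (a n - (- 1) ^ n * a n) / 2) = (\<lambda>n. if odd n then a n else 0)"
    by (auto simp: fun_eq_iff)
  ultimately have *: "(\<lambda>n. if even n then a n else 0) sums ((s + t) / 2)"
    "(\<lambda>n. if odd n then a n else 0) sums ((s - t) / 2)" by simp_all
  have "(\<lambda>n. if even (2 * n) then a (2 * n) else 0) sums ((s + t) / 2)"
    by (subst sums_mono_reindex[of "\<lambda>n. 2 * n" "\<lambda>n. if even n then a n else 0"])
      (use *(1) in \<open>auto simp: strict_mono_def elim!: evenE\<close>)
  then show "(\<lambda>n. a (2 * n)) sums ((s + t) / 2)" by simp
  have "(\<lambda>n. if odd (2 * n + 1) then a (2 * n + 1) else 0) sums ((s - t) / 2)"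
    by (subst sums_mono_reindex[of "\<lambda>n. 2 * n + 1" "\<lambda>n. if odd n then a n else 0"])
      (use *(2) in \<open>auto simp: strict_mono_def elim!: oddE\<close>)
  then show "(\<lambda>n. a (2 * n + 1)) sums ((s - t) / 2)" by simp
qed

text \<open>This instance of the duplication formula converts the coefficients of half-integer
  Bessel series into those of exponential series.\<close>

lemma rGamma_half_nat:
  "rGamma (of_nat k + 1 / 2 :: complex) = 4 ^ k * fact k / (fact (2 * k) * of_real (sqrt pi))"
proof (induction k)
  case 0
  show ?case using Gamma_one_half_complex by (simp add: rGamma_inverse_Gamma field_simps)
next
  case (Suc k)
  have ne: "of_nat k + 1 / 2 \<noteq> (0 :: complex)"
    by (simp add: complex_eq_iff)
  have "rGamma (of_nat (Suc k) + 1 / 2 :: complex) = rGamma (of_nat k + 1 / 2) / (of_nat k + 1 / 2)"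
    using rGamma_plus1[of "of_nat k + 1 / 2 :: complex"] ne by (simp add: field_simps)
  also have "\<dots> = 4 ^ Suc k * fact (Suc k) / (fact (2 * Suc k) * of_real (sqrt pi))"
  proof -
    have f: "(fact (2 * Suc k) :: complex) = 2 * of_nat (Suc k) * (2 * (of_nat k + 1 / 2)) * fact (2 * k)"
      by (simp add: algebra_simps)
    \<comment> \<open>The cancellation is stated in free variables, so powers and factorials enter
      it as opaque factors.\<close>
    have "a * b / (c * s) / w = 4 * a * (u * b) / (2 * u * (2 * w) * c * s)"
      if "u \<noteq> 0" for a b c s u w :: complex
      using that by simp
    then show ?thesis
      unfolding Suc.IH f power_Suc fact_Suc of_nat_mult of_nat_fact by (simp only: of_nat_neq_0 not_False_eq_True)
  qed
  finally show ?case .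
qed

text \<open>This is the exponential series shifted by two places. The truncated subtraction in
  \<open>(n - 1) * n\<close> is harmless, as the factor \<open>n\<close> vanishes at 0.\<close>

lemma exp_quadratic_sums:
  "(\<lambda>n. of_nat ((n - 1) * n) * z ^ n / fact n) sums (z\<^sup>2 * exp z)" for z :: complex
proof -
  have "(\<lambda>n. z\<^sup>2 * (z ^ n / fact n)) sums (z\<^sup>2 * exp z)"
    using exp_converges[of z] by (intro sums_mult) (simp add: scaleR_conv_of_real field_simps)
  moreover have "z\<^sup>2 * (z ^ n / fact n) = of_nat ((n + 2 - 1) * (n + 2)) * z ^ (n + 2) / fact (n + 2)" for n
  proof -
    have "(fact (n + 2) :: complex) = of_nat ((n + 1) * (n + 2)) * fact n"
      by (simp add: algebra_simps)
    moreover have "of_nat ((n + 1) * (n + 2)) \<noteq> (0 :: complex)" by (simp only: of_nat_eq_0_iff) simp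
    ultimately show ?thesis
      by (simp only: nonzero_mult_div_cancel_left mult.assoc nonzero_divide_mult_cancel_left mult_divide_mult_cancel_left
          power_add mult.commute[of "z ^ n"] times_divide_eq_right[symmetric] diff_add_inverse2) (simp add: mult.commute)
  qed
  ultimately have "(\<lambda>n. of_nat ((n + 2 - 1) * (n + 2)) * z ^ (n + 2) / fact (n + 2)) sums (z\<^sup>2 * exp z)"
    by simp
  then show ?thesis
    by (subst (asm) sums_iff_shift[of _ 2]) (simp add: numeral_2_eq_2)
qed

lemma exp_linear_sums:
  "(\<lambda>n. of_nat n * z ^ n / fact n) sums (z * exp z)" for z :: complex
proof -
  have "(\<lambda>n. z * (z ^ n / fact n)) sums (z * exp z)"
    using exp_converges[of z] by (intro sums_mult) (simp add: scaleR_conv_of_real field_simps)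
  moreover have "z * (z ^ n / fact n) = of_nat (Suc n) * z ^ Suc n / fact (Suc n)" for n
    by (simp add: divide_simps del: of_nat_Suc)
  ultimately have "(\<lambda>n. of_nat (Suc n) * z ^ Suc n / fact (Suc n)) sums (z * exp z)"
    by simp
  then show ?thesis
    by (subst (asm) sums_Suc_iff) simp
qed

text \<open>The quadratic factor is \<open>n * (n - 1) - 3 * n + 3\<close>, read off from
  \<open>(z^2 - 3 * z + 3) * exp z\<close>. Its zeros at 1 and 3 make the odd part start at
  \<open>z^5\<close>, the gap between the leading powers of \<open>I_{-5/2}\<close> and
  \<open>I_{5/2}\<close>.\<close>

definition bessel52_coeff :: "complex \<Rightarrow> nat \<Rightarrow> complex" where
  "bessel52_coeff z n = (of_nat n - 1) * (of_nat n - 3) * z ^ n / fact n"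

lemma bessel52_coeff_sums: "bessel52_coeff z sums ((z\<^sup>2 - 3 * z + 3) * exp z)"
proof -
  have "(\<lambda>n. of_nat ((n - 1) * n) * z ^ n / fact n - 3 * (of_nat n * z ^ n / fact n) + 3 * (z ^ n / fact n))
      sums (z\<^sup>2 * exp z - 3 * (z * exp z) + 3 * exp z)"
    using exp_converges[of z]
    by (intro sums_add sums_diff sums_mult exp_quadratic_sums exp_linear_sums)
      (simp add: scaleR_conv_of_real field_simps)
  moreover have "of_nat ((n - 1) * n) * z ^ n / fact n - 3 * (of_nat n * z ^ n / fact n) + 3 * (z ^ n / fact n)
      = bessel52_coeff z n" for n
    by (cases n) (simp_all add: bessel52_coeff_def field_simps del: fact_Suc power_Suc)
  ultimately show ?thesis by (simp add: algebra_simps)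
qed

lemma bessel52_coeff_neg_sums:
  "(\<lambda>n. (- 1) ^ n * bessel52_coeff z n) sums ((z\<^sup>2 + 3 * z + 3) * exp (- z))"
proof -
  have "(\<lambda>n. (- 1) ^ n * bessel52_coeff z n) = bessel52_coeff (- z)"
    by (auto simp: bessel52_coeff_def fun_eq_iff power_minus[of z])
  then show ?thesis using bessel52_coeff_sums[of "- z"] by simp
qed

text \<open>Two recurrence steps take \<open>rGamma (k - 3/2)\<close> to
  \<open>rGamma (k + 1/2)\<close> and produce \<open>(2 * k - 1) * (2 * k - 3) / 4\<close>, the
  even-index coefficient together with the factor \<open>1/4\<close>.\<close>

lemma bessel_I_minus_5_2:
  "bessel_I (- (5 / 2)) z = (z / 2) powr (- (5 / 2)) / (4 * of_real (sqrt pi)) *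
     (((z\<^sup>2 - 3 * z + 3) * exp z + (z\<^sup>2 + 3 * z + 3) * exp (- z)) / 2)"
proof -
  have "rGamma (- (5 / 2) + of_nat k + 1) * (z\<^sup>2 / 4) ^ k / fact k
      = bessel52_coeff z (2 * k) / (4 * of_real (sqrt pi))" for k
  proof -
    have "rGamma (- (5 / 2) + of_nat k + 1 :: complex)
        = (of_nat k - 3 / 2) * ((of_nat k - 1 / 2) * rGamma (of_nat k + 1 / 2))"
      using rGamma_plus1[of "of_nat k - 3 / 2 :: complex"] rGamma_plus1[of "of_nat k - 1 / 2 :: complex"]
      by (simp add: algebra_simps)
    then show ?thesis
      unfolding rGamma_half_nat bessel52_coeff_def
      by (simp add: power_divide power_mult divide_simps) (simp add: algebra_simps)
  qed
  moreover have "(\<lambda>k. bessel52_coeff z (2 * k) / (4 * of_real (sqrt pi))) sums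
      ((((z\<^sup>2 - 3 * z + 3) * exp z + (z\<^sup>2 + 3 * z + 3) * exp (- z)) / 2) / (4 * of_real (sqrt pi)))"
    by (intro sums_divide sums_even_odd(1) bessel52_coeff_sums bessel52_coeff_neg_sums)
  ultimately show ?thesis
    by (simp add: bessel_I_def sums_iff)
qed

text \<open>The prefactor is that of order \<open>- 5/2\<close>, so that the two functions can be
  subtracted. The remaining \<open>(z / 2)^5\<close> goes into the series, whose \<open>k\<close>-th
  term becomes the odd coefficient of index \<open>2 * k + 5\<close>.\<close>

lemma bessel_I_5_2:
  assumes "z \<noteq> 0"
  shows "bessel_I (5 / 2) z = (z / 2) powr (- (5 / 2)) / (4 * of_real (sqrt pi)) *
     (((z\<^sup>2 - 3 * z + 3) * exp z - (z\<^sup>2 + 3 * z + 3) * exp (- z)) / 2)"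
proof -
  have "rGamma (5 / 2 + of_nat k + 1) * (z\<^sup>2 / 4) ^ k / fact k * (z / 2) ^ 5
      = bessel52_coeff z (2 * (k + 2) + 1) / (4 * of_real (sqrt pi))" for k
  proof -
    have eq: "rGamma (5 / 2 + of_nat k + 1 :: complex) = rGamma (of_nat (k + 3) + 1 / 2)"
      by (simp add: algebra_simps)
    have f1: "(fact (k + 3) :: complex) = (of_nat k + 3) * (of_nat k + 2) * (of_nat k + 1) * fact k"
      by (simp add: eval_nat_numeral algebra_simps)
    have f2: "(fact (2 * (k + 3)) :: complex) = 2 * (of_nat k + 3) * fact (2 * (k + 2) + 1)"
      by (simp add: eval_nat_numeral algebra_simps)
    have "(of_nat k + 3 :: complex) \<noteq> 0" by (simp add: complex_eq_iff)
    moreover have *: "a * (u * v * w * b) / (2 * u * c * s) / b = a * v * w / (2 * c * s)"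
      if "u \<noteq> 0" "b \<noteq> 0" for a b c s u v w :: complex
      using that by (simp add: mult.assoc)
    moreover define F :: complex where "F = fact (2 * (k + 2) + 1)"
    ultimately have "rGamma (of_nat (k + 3) + 1 / 2 :: complex) / fact k =
       4 ^ (k + 3) * (of_nat k + 2) * (of_nat k + 1) / (2 * fact (2 * (k + 2) + 1) * of_real (sqrt pi))"
      unfolding rGamma_half_nat f1 f2 F_def[symmetric] by (simp only: * fact_nonzero not_False_eq_True)
    moreover have "g * a / b * c = g / b * (a * c)" for a b c g :: complex by simp
    ultimately have "rGamma (5 / 2 + of_nat k + 1) * (z\<^sup>2 / 4) ^ k / fact k * (z / 2) ^ 5 =
       4 ^ (k + 3) * (of_nat k + 2) * (of_nat k + 1) / (2 * fact (2 * (k + 2) + 1) * of_real (sqrt pi))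
       * ((z\<^sup>2 / 4) ^ k * (z / 2) ^ 5)"
      unfolding eq by presburger
    also have "(z\<^sup>2 / 4) ^ k * (z / 2) ^ 5 = z ^ (2 * k + 5) / (4 ^ k * 32)"
      by (simp only: power_add power_mult power_divide) simp
    also have "4 ^ (k + 3) * (of_nat k + 2) * (of_nat k + 1) / (2 * fact (2 * (k + 2) + 1) * of_real (sqrt pi))
        * (z ^ (2 * k + 5) / (4 ^ k * 32)) =
        4 * (of_nat k + 2) * (of_nat k + 1) * z ^ (2 * k + 5) / fact (2 * (k + 2) + 1) / (4 * of_real (sqrt pi))"
    proof -
      have cancel: "4 ^ 3 * A * u * v / (2 * F * s) * (Z / (A * 32)) = 4 * u * v * Z / F / (4 * s)"
        if "A \<noteq> 0" for A u v F s Z :: complex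
        using that by (simp add: mult_ac)
      show ?thesis
        unfolding power_add[of 4 k 3] mult.commute[of "4 ^ k" "4 ^ 3"] by (rule cancel) simp
    qed
    also have "4 * (of_nat k + 2) * (of_nat k + 1) * z ^ (2 * k + 5) / fact (2 * (k + 2) + 1)
        = bessel52_coeff z (2 * (k + 2) + 1)"
    proof -
      have "2 * (k + 2) + 1 = 2 * k + 5" by simp
      moreover have "(of_nat (2 * k + 5) - 1) * (of_nat (2 * k + 5) - 3) = 4 * (of_nat k + 2) * (of_nat k + 1 :: complex)"
        by (simp add: algebra_simps)
      ultimately show ?thesis unfolding bessel52_coeff_def by (simp only:)
    qed
    finally show ?thesis .
  qed
  moreover have "(\<lambda>k. bessel52_coeff z (2 * (k + 2) + 1) / (4 * of_real (sqrt pi))) sums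
      ((((z\<^sup>2 - 3 * z + 3) * exp z - (z\<^sup>2 + 3 * z + 3) * exp (- z)) / 2) / (4 * of_real (sqrt pi)))"
  proof (intro sums_divide)
    show "(\<lambda>k. bessel52_coeff z (2 * (k + 2) + 1)) sums
        (((z\<^sup>2 - 3 * z + 3) * exp z - (z\<^sup>2 + 3 * z + 3) * exp (- z)) / 2)"
      using sums_even_odd(2)[OF bessel52_coeff_sums bessel52_coeff_neg_sums, of z]
      \<comment> \<open>The two skipped terms have indices 1 and 3, where the coefficient is
        zero.\<close>
      by (subst sums_iff_shift[of "\<lambda>k. bessel52_coeff z (2 * k + 1)" 2])
        (simp add: numeral_2_eq_2 bessel52_coeff_def)
  qed
  ultimately have "(\<lambda>k. rGamma (5 / 2 + of_nat k + 1) * (z\<^sup>2 / 4) ^ k / fact k * (z / 2) ^ 5) sums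
      ((((z\<^sup>2 - 3 * z + 3) * exp z - (z\<^sup>2 + 3 * z + 3) * exp (- z)) / 2) / (4 * of_real (sqrt pi)))"
    (is "?f sums ?D") by (simp only:)
  then have "(\<lambda>k. ?f k / (z / 2) ^ 5) sums (?D / (z / 2) ^ 5)"
    by (rule sums_divide)
  then have "(\<lambda>k. rGamma (5 / 2 + of_nat k + 1) * (z\<^sup>2 / 4) ^ k / fact k) sums (?D / (z / 2) ^ 5)"
    using assms by simp
  then have q: "?D / (z / 2) ^ 5 = (\<Sum>k. rGamma (5 / 2 + of_nat k + 1) * (z\<^sup>2 / 4) ^ k / fact k)"
    by (rule sums_unique)
  have S: "?D = (z / 2) ^ 5 * (\<Sum>k. rGamma (5 / 2 + of_nat k + 1) * (z\<^sup>2 / 4) ^ k / fact k)"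
    unfolding q[symmetric] using assms by simp
  have p: "(z / 2) powr (5 / 2) = (z / 2) powr (- (5 / 2)) * (z / 2) ^ 5"
    using assms powr_add[of "z / 2" "- (5 / 2)" 5] by simp
  have "bessel_I (5 / 2) z = (z / 2) powr (- (5 / 2)) * ?D"
    unfolding bessel_I_def p S by (simp only: mult.assoc)
  then show ?thesis by simp
qed

text \<open>Since \<open>sin (5/2 * pi) = 1\<close>, \<open>K\<close> is \<open>pi / 2\<close> times
  the difference of the two closed forms, in which the parts with \<open>exp z\<close>
  cancel.\<close>

lemma macdonald_K_5_2:
  assumes "z \<noteq> 0"
  shows "macdonald_K (5 / 2) z = of_real (sqrt (pi / 2)) / csqrt z * (3 / z\<^sup>2 + 3 / z + 1) * exp (- z)"
proof -
  have ni: "(5 / 2 :: complex) \<notin> \<int>"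
    using fraction_not_in_Ints[of 2 5, where 'a = complex] by simp
  have "sin (5 / 2 * of_real pi :: complex) = of_real (sin (2 * pi + pi / 2))"
    by (simp add: sin_of_real[symmetric] field_simps)
  also have "sin (2 * pi + pi / 2) = 1" by (subst sin_add) simp
  finally have s: "sin (5 / 2 * of_real pi :: complex) = 1" by simp
  have p: "(z / 2) powr (- (5 / 2)) = 4 * of_real (sqrt 2) / (z\<^sup>2 * csqrt z)"
  proof -
    have "Ln (z / 2) = Ln z - of_real (ln 2)"
      using Ln_divide_of_real[of 2 z] assms by simp
    then have "(z / 2) powr (- (5 / 2)) = exp (- (5 / 2) * Ln z) * exp (5 / 2 * of_real (ln 2))"
      using assms by (simp only: powr_def exp_add[symmetric]) (simp add: right_diff_distrib)
    also have "exp (5 / 2 * of_real (ln 2) :: complex) = of_real (2 powr (5 / 2))"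
      by (simp add: powr_def exp_of_real[symmetric])
    also have "(2 :: real) powr (5 / 2) = 4 * sqrt 2"
      using powr_add[of 2 2 "1 / 2 :: real"] by (simp add: powr_half_sqrt)
    finally have "(z / 2) powr (- (5 / 2)) = exp (- (5 / 2) * Ln z) * (4 * of_real (sqrt 2))" by simp
    moreover have "exp (- (5 / 2) * Ln z) * (z\<^sup>2 * csqrt z) = 1"
    proof -
      have "z\<^sup>2 * csqrt z = exp (2 * Ln z) * exp (Ln z / 2)"
        using assms by (simp add: csqrt_exp_Ln exp_double)
      then show ?thesis by (simp flip: exp_add)
    qed
    ultimately show ?thesis using assms by (simp add: field_simps)
  qed
  have c: "pi / 2 * (4 * sqrt 2 / (4 * sqrt pi)) = sqrt (pi / 2)"
    using real_sqrt_pow2[of pi] by (simp add: real_sqrt_divide field_simps power2_eq_square)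
  have "macdonald_K (5 / 2) z = of_real pi / 2 * (bessel_I (- (5 / 2)) z - bessel_I (5 / 2) z)"
    using ni s by (simp add: macdonald_K_def Let_def)
  also have "\<dots> = of_real pi / 2 * ((z / 2) powr (- (5 / 2)) / (4 * of_real (sqrt pi)) * ((z\<^sup>2 + 3 * z + 3) * exp (- z)))"
    unfolding bessel_I_minus_5_2 bessel_I_5_2[OF assms] by (simp add: field_simps)
  also have "\<dots> = of_real (sqrt (pi / 2)) / csqrt z * (3 / z\<^sup>2 + 3 / z + 1) * exp (- z)"
  proof -
    have "of_real pi / 2 * ((z / 2) powr (- (5 / 2)) / (4 * of_real (sqrt pi)) * ((z\<^sup>2 + 3 * z + 3) * exp (- z))) =
        of_real (pi / 2 * (4 * sqrt 2 / (4 * sqrt pi))) / csqrt z * ((z\<^sup>2 + 3 * z + 3) / z\<^sup>2) * exp (- z)"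
      unfolding p by (simp add: mult_ac)
    also have "(z\<^sup>2 + 3 * z + 3) / z\<^sup>2 = 3 / z\<^sup>2 + 3 / z + 1"
      using assms by (simp add: field_simps power2_eq_square)
    finally show ?thesis unfolding c .
  qed
  finally show ?thesis .
qed

section \<open>Antiderivatives\<close>

text \<open>The entire integrand has a primitive on the plane, so the integral along the segment is
  a difference of its values.\<close>

lemma has_field_derivative_erf:
  "(erf has_field_derivative 2 / of_real (sqrt pi) * exp (- z\<^sup>2)) (at z)"
proof -
  define g :: "complex \<Rightarrow> complex" where "g = (\<lambda>t. exp (- t\<^sup>2))"
  have "g holomorphic_on UNIV"
    unfolding g_def by (intro holomorphic_intros)
  then obtain G where G: "\<And>x. (G has_field_derivative g x) (at x)"
    using holomorphic_convex_primitive'[of UNIV g] by auto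
  have "contour_integral (linepath 0 w) g = G w - G 0" for w
    using contour_integral_primitive[of UNIV G g "linepath 0 w"] G
    by (auto intro!: contour_integral_unique intro: has_field_derivative_at_within)
  then have "erf = (\<lambda>w. 2 / of_real (sqrt pi) * (G w - G 0))"
    by (auto simp: erf_def g_def fun_eq_iff)
  then show ?thesis
    using DERIV_cmult[OF DERIV_diff[OF G[of z] DERIV_const[of "G 0"]], of "2 / of_real (sqrt pi)"]
    by (simp add: g_def)
qed

text \<open>\<open>h\<close> is kept general to serve both integrals, and \<open>E\<close> stands
  for the Gaussian factor. The condition on the roots cancels \<open>csqrt (b * x)\<close> against
  the half-powers of \<open>b\<close> and \<open>x\<close>.\<close>

lemma bessel_integrand_eq_exp:
  assumes "b \<noteq> 0" "x \<noteq> 0" "csqrt (b * x) = csqrt b * csqrt x"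
  shows "of_real (sqrt (2 / pi)) * (E * b powr (2 + 1/2) * x powr (h + 1/2) * macdonald_K (5/2) (b * x)) =
         b\<^sup>2 * (x powr h * (3 / (b\<^sup>2 * x\<^sup>2) + 3 / (b * x) + 1) * (E * exp (- (b * x))))"
proof -
  have "of_real (sqrt (2 / pi)) * of_real (sqrt (pi / 2)) = (1 :: complex)"
    by (simp flip: of_real_mult real_sqrt_mult)
  moreover have "b powr (2 + 1/2) = b\<^sup>2 * csqrt b" "x powr (h + 1/2) = x powr h * csqrt x"
    by (simp_all only: powr_add csqrt_conv_powr powr_complexnumeral)
  moreover have "b * x \<noteq> 0" "csqrt b \<noteq> 0" "csqrt x \<noteq> 0" using assms by auto
  moreover have "r * (E * (B * p) * (X * q) * (s / (p * q) * P * e)) = r * s * (B * (X * P * (E * e)))"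
    if "p \<noteq> 0" "q \<noteq> 0" for r E B p X q s P e :: complex
    using that by (simp add: mult_ac)
  ultimately show ?thesis
    by (simp only: macdonald_K_5_2 assms(3) power_mult_distrib mult_1_left not_False_eq_True)
qed

lemma half_meijer_G_eq_macdonald_K_5_2:
  assumes "b \<noteq> 0" "x \<noteq> 0" "csqrt (b\<^sup>2 * x\<^sup>2) = b * x"
  shows "1/2 * meijer_G_20_02 (b\<^sup>2 * x\<^sup>2 / 4) (5/4) (- 5/4) = macdonald_K (5/2) (b * x)"
proof -
  have "(5 / 2 :: real) \<notin> \<int>"
    using fraction_not_in_Ints[of 2 5, where 'a = real] by simp
  then show ?thesis
    using meijer_G_20_02_eq_macdonald_K[of "b * x" "5 / 2"] assms by (simp add: power_mult_distrib)
qed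

text \<open>Completing the square: the factor \<open>exp (b^2 / (4 * a))\<close> removes the
  constant left in the Gaussian. With \<open>s = sqrt a\<close> the computation is rational in
  \<open>s\<close>.\<close>

lemma has_field_derivative_erf_linear:
  fixes a :: real
  assumes "a > 0"
  shows "((\<lambda>x. exp (b\<^sup>2 / (4 * of_real a)) * erf ((2 * of_real a * x + b) / (2 * of_real (sqrt a))))
           has_field_derivative 2 * of_real (sqrt a) / of_real (sqrt pi) * exp (- of_real a * x\<^sup>2 - b * x)) (at x)"
proof -
  define s where "s = complex_of_real (sqrt a)"
  have s: "s \<noteq> 0" "of_real a = s\<^sup>2" using assms by (auto simp: s_def simp flip: of_real_power)
  have "((\<lambda>x. (2 * s\<^sup>2 * x + b) / (2 * s)) has_field_derivative s) (at x)"
    using s(1) by (auto intro!: derivative_eq_intros simp: power2_eq_square)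
  from DERIV_cmult[OF DERIV_chain2[OF has_field_derivative_erf this], of "exp (b\<^sup>2 / (4 * s\<^sup>2))"]
  have "((\<lambda>x. exp (b\<^sup>2 / (4 * s\<^sup>2)) * erf ((2 * s\<^sup>2 * x + b) / (2 * s))) has_field_derivative
     exp (b\<^sup>2 / (4 * s\<^sup>2)) * (2 / of_real (sqrt pi) * exp (- ((2 * s\<^sup>2 * x + b) / (2 * s))\<^sup>2) * s)) (at x)" .
  moreover have "exp (b\<^sup>2 / (4 * s\<^sup>2)) * (2 / of_real (sqrt pi) * exp (- ((2 * s\<^sup>2 * x + b) / (2 * s))\<^sup>2) * s)
      = 2 * s / of_real (sqrt pi) * exp (b\<^sup>2 / (4 * s\<^sup>2) + - ((2 * s\<^sup>2 * x + b) / (2 * s))\<^sup>2)"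
    unfolding exp_add by simp
  moreover have "b\<^sup>2 / (4 * s\<^sup>2) + - ((2 * s\<^sup>2 * x + b) / (2 * s))\<^sup>2 = - s\<^sup>2 * x\<^sup>2 - b * x"
    using s(1) by (simp add: field_simps power2_eq_square)
  ultimately show ?thesis
    unfolding s(2) by (simp only: flip: s_def)
qed

text \<open>Differentiating the elementary part gives the integrand minus \<open>4 * a^2\<close>
  times the exponential; the factor \<open>a powr (3/2)\<close> is what makes the error function
  term restore it.\<close>

lemma has_field_derivative_antiderivative_minus_2:
  fixes a :: real
  assumes "a > 0" "b \<noteq> 0" "x \<noteq> 0"
  shows "((\<lambda>x. 2 * of_real (sqrt pi) * of_real (a powr (3/2)) * exp (b\<^sup>2 / (4 * of_real a))
              * erf ((2 * of_real a * x + b) / (2 * of_real (sqrt a)))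
            + exp (- of_real a * x\<^sup>2 - b * x) * (2 * of_real a / x - b / x\<^sup>2 - 1 / x ^ 3))
           has_field_derivative
           b\<^sup>2 * (1 / x\<^sup>2 * (3 / (b\<^sup>2 * x\<^sup>2) + 3 / (b * x) + 1) * exp (- of_real a * x\<^sup>2 - b * x))) (at x)"
proof -
  let ?A = "complex_of_real a" and ?E = "exp (- of_real a * x\<^sup>2 - b * x)"
  have "((\<lambda>x. 2 * ?A / x - b / x\<^sup>2 - 1 / x ^ 3) has_field_derivative
      - 2 * ?A / x\<^sup>2 + 2 * b / x ^ 3 + 3 / x ^ 4) (at x)"
    using assms(3) by (auto intro!: derivative_eq_intros simp: field_simps eval_nat_numeral)
  moreover have "((\<lambda>x. exp (- ?A * x\<^sup>2 - b * x)) has_field_derivative (- 2 * ?A * x - b) * ?E) (at x)"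
    by (auto intro!: derivative_eq_intros simp: algebra_simps)
  ultimately have alg: "((\<lambda>x. exp (- ?A * x\<^sup>2 - b * x) * (2 * ?A / x - b / x\<^sup>2 - 1 / x ^ 3)) has_field_derivative
      (- 2 * ?A * x - b) * ?E * (2 * ?A / x - b / x\<^sup>2 - 1 / x ^ 3)
      + (- 2 * ?A / x\<^sup>2 + 2 * b / x ^ 3 + 3 / x ^ 4) * ?E) (at x)"
    by (rule DERIV_mult[rotated])
  have "a powr (3 / 2) = a * sqrt a"
    using assms(1) powr_add[of a 1 "1 / 2"] by (simp add: powr_half_sqrt)
  then have "sqrt pi * a powr (3/2) * (sqrt a / sqrt pi) = a\<^sup>2"
    using assms(1) by (simp add: power2_eq_square)
  then have c: "of_real (sqrt pi) * of_real (a powr (3/2)) * (of_real (sqrt a) / of_real (sqrt pi)) = ?A\<^sup>2"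
    by (metis of_real_mult of_real_divide of_real_power)
  have "2 * of_real (sqrt pi) * of_real (a powr (3/2)) * (2 * of_real (sqrt a) / of_real (sqrt pi) * ?E)
      = 4 * (of_real (sqrt pi) * of_real (a powr (3/2)) * (of_real (sqrt a) / of_real (sqrt pi))) * ?E"
    by (simp add: mult_ac)
  also have "\<dots> = 4 * ?A\<^sup>2 * ?E" unfolding c ..
  finally have "((\<lambda>x. 2 * of_real (sqrt pi) * of_real (a powr (3/2)) * (exp (b\<^sup>2 / (4 * ?A))
              * erf ((2 * ?A * x + b) / (2 * of_real (sqrt a))))) has_field_derivative 4 * ?A\<^sup>2 * ?E) (at x)"
    using DERIV_cmult[OF has_field_derivative_erf_linear[OF assms(1), of b x], of "2 * of_real (sqrt pi) * of_real (a powr (3/2))"]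
    by (simp only:)
  from DERIV_add[OF this alg]
  have "((\<lambda>x. 2 * of_real (sqrt pi) * of_real (a powr (3/2)) * (exp (b\<^sup>2 / (4 * ?A))
              * erf ((2 * ?A * x + b) / (2 * of_real (sqrt a))))
            + exp (- ?A * x\<^sup>2 - b * x) * (2 * ?A / x - b / x\<^sup>2 - 1 / x ^ 3)) has_field_derivative
      4 * ?A\<^sup>2 * ?E + ((- 2 * ?A * x - b) * ?E * (2 * ?A / x - b / x\<^sup>2 - 1 / x ^ 3)
      + (- 2 * ?A / x\<^sup>2 + 2 * b / x ^ 3 + 3 / x ^ 4) * ?E)) (at x)" .
  moreover have "4 * A\<^sup>2 * E + ((- 2 * A * x - b) * E * (2 * A / x - b / x\<^sup>2 - 1 / x ^ 3)
      + (- 2 * A / x\<^sup>2 + 2 * b / x ^ 3 + 3 / x ^ 4) * E)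
      = b\<^sup>2 * (1 / x\<^sup>2 * (3 / (b\<^sup>2 * x\<^sup>2) + 3 / (b * x) + 1) * E)" for A E
    using assms(2,3) by (simp add: field_simps eval_nat_numeral)
  ultimately show ?thesis by (simp only: mult.assoc)
qed

text \<open>The term with \<open>1 / x\<close> contributes the singular part of the integrand and an
  excess of \<open>6 * a\<close> times the exponential, so the error function has to supply
  \<open>b^2 - 6 * a\<close>.\<close>

lemma has_field_derivative_antiderivative_0:
  fixes a :: real
  assumes "a > 0" "b \<noteq> 0" "x \<noteq> 0"
  shows "((\<lambda>x. - (of_real (sqrt pi) * (6 * of_real a - b\<^sup>2) * exp (b\<^sup>2 / (4 * of_real a))
              * erf ((2 * of_real a * x + b) / (2 * of_real (sqrt a)))
            / (2 * of_real (sqrt a)))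
            - 3 * exp (- x * (of_real a * x + b)) / x)
           has_field_derivative
           b\<^sup>2 * ((3 / (b\<^sup>2 * x\<^sup>2) + 3 / (b * x) + 1) * exp (- of_real a * x\<^sup>2 - b * x))) (at x)"
proof -
  let ?A = "complex_of_real a" and ?E = "exp (- of_real a * x\<^sup>2 - b * x)"
  have e: "- y * (?A * y + b) = - ?A * y\<^sup>2 - b * y" for y
    by (simp add: algebra_simps power2_eq_square)
  have alg: "((\<lambda>x. 3 * exp (- ?A * x\<^sup>2 - b * x) / x) has_field_derivative
      3 * ((- 2 * ?A * x - b) * ?E * x - ?E) / x\<^sup>2) (at x)"
    using assms(3) by (auto intro!: derivative_eq_intros simp: field_simps power2_eq_square)
  let ?c = "- (of_real (sqrt pi) * (6 * ?A - b\<^sup>2)) / (2 * of_real (sqrt a))"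
  have "?c * (2 * of_real (sqrt a) / of_real (sqrt pi) * ?E) = - (6 * ?A - b\<^sup>2) * ?E"
    using assms(1) by (simp add: field_simps)
  then have "((\<lambda>x. ?c * (exp (b\<^sup>2 / (4 * ?A)) * erf ((2 * ?A * x + b) / (2 * of_real (sqrt a)))))
      has_field_derivative - (6 * ?A - b\<^sup>2) * ?E) (at x)"
    using DERIV_cmult[OF has_field_derivative_erf_linear[OF assms(1), of b x], of ?c] by (simp only:)
  from DERIV_diff[OF this alg]
  have "((\<lambda>x. ?c * (exp (b\<^sup>2 / (4 * ?A)) * erf ((2 * ?A * x + b) / (2 * of_real (sqrt a))))
      - 3 * exp (- ?A * x\<^sup>2 - b * x) / x) has_field_derivative
      - (6 * ?A - b\<^sup>2) * ?E - 3 * ((- 2 * ?A * x - b) * ?E * x - ?E) / x\<^sup>2) (at x)" .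
  moreover have "- (6 * A - b\<^sup>2) * E - 3 * ((- 2 * A * x - b) * E * x - E) / x\<^sup>2
      = b\<^sup>2 * ((3 / (b\<^sup>2 * x\<^sup>2) + 3 / (b * x) + 1) * E)" for A E
    using assms(2,3) by (simp add: field_simps power2_eq_square)
  moreover have "?c * (u * v) = - (of_real (sqrt pi) * (6 * ?A - b\<^sup>2) * u * v / (2 * of_real (sqrt a)))" for u v
    by (simp add: mult_ac)
  ultimately show ?thesis unfolding e by (simp only:)
qed

text \<open>Equality of indefinite integrals is expressed pointwise: the integrands agree at each
  nonzero \<open>x\<close>, and \<open>F\<close> has them as its derivative. Each root convention is
  attached to the equalities that rest on it, the first for the G-function and the second for the
  passage to exponentials.\<close>

theorem mainTheorem3:
  fixes a :: real and b :: complex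
  assumes "a > 0" and "b \<noteq> 0"
  shows
    "(let
        intG = (\<lambda>x. of_real (sqrt (2 / pi)) * (exp (- of_real a * x\<^sup>2) * b powr (2 + 1/2) * x powr ((-2) + 1/2)
              * (1/2 * meijer_G_20_02 (b\<^sup>2 * x\<^sup>2 / 4) (5/4) (- 5/4))));
        intK = (\<lambda>x. of_real (sqrt (2 / pi)) * (exp (- of_real a * x\<^sup>2) * b powr (2 + 1/2) * x powr ((-2) + 1/2)
              * macdonald_K (5/2) (b * x)));
        intE = (\<lambda>x. b\<^sup>2 * (1 / x\<^sup>2 * (3 / (b\<^sup>2 * x\<^sup>2) + 3 / (b * x) + 1) * exp (- of_real a * x\<^sup>2 - b * x)));
        F = (\<lambda>x. 2 * of_real (sqrt pi) * of_real (a powr (3/2)) * exp (b\<^sup>2 / (4 * of_real a))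
              * erf ((2 * of_real a * x + b) / (2 * of_real (sqrt a)))
            + exp (- of_real a * x\<^sup>2 - b * x) * (2 * of_real a / x - b / x\<^sup>2 - 1 / x ^ 3))
      in \<forall>x. x \<noteq> 0 \<longrightarrow>
           (csqrt (b\<^sup>2 * x\<^sup>2) = b * x \<longrightarrow> V_integrand (-2) 2 a b x = intG x \<and> intG x = intK x)
         \<and> V_integrand (-2) 2 a b x = intK x
         \<and> (csqrt (b * x) = csqrt b * csqrt x \<longrightarrow>
              intK x = intE x \<and> (F has_field_derivative V_integrand (-2) 2 a b x) (at x))
         \<and> (F has_field_derivative intE x) (at x))
     \<and>
     (let
        intG = (\<lambda>x. of_real (sqrt (2 / pi)) * (exp (- of_real a * x\<^sup>2) * b powr (2 + 1/2) * x powr (0 + 1/2)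
              * (1/2 * meijer_G_20_02 (b\<^sup>2 * x\<^sup>2 / 4) (5/4) (- 5/4))));
        intK = (\<lambda>x. of_real (sqrt (2 / pi)) * (exp (- of_real a * x\<^sup>2) * b powr (2 + 1/2) * x powr (0 + 1/2)
              * macdonald_K (5/2) (b * x)));
        intE = (\<lambda>x. b\<^sup>2 * ((3 / (b\<^sup>2 * x\<^sup>2) + 3 / (b * x) + 1) * exp (- of_real a * x\<^sup>2 - b * x)));
        F = (\<lambda>x. - (of_real (sqrt pi) * (6 * of_real a - b\<^sup>2) * exp (b\<^sup>2 / (4 * of_real a))
              * erf ((2 * of_real a * x + b) / (2 * of_real (sqrt a)))
            / (2 * of_real (sqrt a)))
            - 3 * exp (- x * (of_real a * x + b)) / x)
      in \<forall>x. x \<noteq> 0 \<longrightarrow>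
           (csqrt (b\<^sup>2 * x\<^sup>2) = b * x \<longrightarrow> V_integrand 0 2 a b x = intG x \<and> intG x = intK x)
         \<and> V_integrand 0 2 a b x = intK x
         \<and> (csqrt (b * x) = csqrt b * csqrt x \<longrightarrow>
              intK x = intE x \<and> (F has_field_derivative V_integrand 0 2 a b x) (at x))
         \<and> (F has_field_derivative intE x) (at x))"
proof -
  have K: "V_integrand h 2 a b x = of_real (sqrt (2 / pi)) * (exp (- of_real a * x\<^sup>2) * b powr (2 + 1/2) * x powr (h + 1/2)
              * macdonald_K (5/2) (b * x))" for h x
    by (simp add: V_integrand_def)
  have exp: "exp (- of_real a * x\<^sup>2) * exp (- (b * x)) = exp (- of_real a * x\<^sup>2 - b * x)" for x
    by (simp flip: exp_add)
  have powr: "x powr (- 2) = 1 / x\<^sup>2" "x powr 0 = 1" if "x \<noteq> 0" for x :: complex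
    using that by (simp_all add: powr_minus divide_inverse)
  have E1: "of_real (sqrt (2 / pi)) * (exp (- of_real a * x\<^sup>2) * b powr (2 + 1/2) * x powr ((-2) + 1/2) * macdonald_K (5/2) (b * x))
      = b\<^sup>2 * (1 / x\<^sup>2 * (3 / (b\<^sup>2 * x\<^sup>2) + 3 / (b * x) + 1) * exp (- of_real a * x\<^sup>2 - b * x))"
    if "x \<noteq> 0" "csqrt (b * x) = csqrt b * csqrt x" for x
    unfolding bessel_integrand_eq_exp[OF assms(2) that] powr[OF that(1)] exp ..
  have E2: "of_real (sqrt (2 / pi)) * (exp (- of_real a * x\<^sup>2) * b powr (2 + 1/2) * x powr (0 + 1/2) * macdonald_K (5/2) (b * x))
      = b\<^sup>2 * ((3 / (b\<^sup>2 * x\<^sup>2) + 3 / (b * x) + 1) * exp (- of_real a * x\<^sup>2 - b * x))"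
    if "x \<noteq> 0" "csqrt (b * x) = csqrt b * csqrt x" for x
    unfolding bessel_integrand_eq_exp[OF assms(2) that] powr[OF that(1)] exp mult_1_left ..
  note D1 = has_field_derivative_antiderivative_minus_2[OF assms]
  note D2 = has_field_derivative_antiderivative_0[OF assms]
  note G = half_meijer_G_eq_macdonald_K_5_2[OF assms(2)]
  show ?thesis
    unfolding Let_def K
    by (intro conjI allI impI) (simp_all only: G E1 E2 D1 D2 not_False_eq_True)
qed

end
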